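(* For any $r\in(0,1)$ there is a universal constant $C_r>0$ (depending only on $r$) with the following property. Let $\lambda(z)\,|dz|$ and $\mu(z)\,|dz|$ be conformal pseudometrics on the unit disk $\mathbb{D}$ with $\kappa_\mu=\kappa$ for some locally H\"older continuous function $\kappa:\mathbb{D}\to\mathbb{R}$ such that $-c\le\kappa(z)\le-4$ for some $c>0$. Suppose that $\lambda\preceq\mu$. Then $$\log\frac{\lambda(z)}{\mu(z)}\le\frac{C_r}{(1-r^2)^{c/2}}\cdot\Big(\max_{|\xi|=r}\log\frac{\lambda(\xi)}{\mu(\xi)}\Big)\,(1-|z|^2)^{c/2}\qquad\text{on } r\le|z|<1.$$ In particular, if $\lambda(z_0)/\mu(z_0)<1$ for one point $z_0\in\mathbb{D}$, then $\lambda(z)/\mu(z)<1$ for all $z\in\mathbb{D}$ and $$\limsup_{|z|\to1}\frac{\log\frac{\lambda(z)}{\mu(z)}}{(1-|z|)^{c/2}}<0.$$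
   Context: A conformal pseudometric $\lambda(z)\,|dz|$ on a domain $G\subset\mathbb{C}$ is a continuous function $\lambda:G\to[0,\infty)$ which is of class $C^2$ on $\{\lambda>0\}$; its curvature $\kappa_\lambda(z)=-\Delta(\log\lambda)(z)/\lambda(z)^2$ is defined where $\lambda(z)>0$, and (in)equalities for $\kappa_\lambda$ are understood at all points with $\lambda(z)>0$. One writes $\lambda\preceq\mu$ on $G$ if (i) $\kappa_\lambda\le\kappa_\mu$ in $G$, and (ii) $\mu$ has only isolated zeros in $G$ and $\lambda/\mu$ has a continuous extension from $\{z\in G:\mu(z)\ne 0\}$ to $G$ with values in $[0,1]$; then $\lambda(z)/\mu(z)$ denotes the value of this extension at any $z\in G$. The convention $\log 0=-\infty$ is used. *)

theory Defs
  imports "HOL-Analysis.Analysis"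
begin

text \<open>Functions on plane domains are total functions on \<^typ>\<open>complex\<close>; their values outside the
  domain are irrelevant.\<close>

definition dir_deriv :: "complex \<Rightarrow> (complex \<Rightarrow> real) \<Rightarrow> complex \<Rightarrow> real" where
  "dir_deriv v u z = deriv (\<lambda>t::real. u (z + t *\<^sub>R v)) 0"

definition C1_on :: "complex set \<Rightarrow> (complex \<Rightarrow> real) \<Rightarrow> bool" where
  "C1_on S u \<longleftrightarrow> (\<forall>v\<in>{1, \<i>}.
     (\<forall>z\<in>S. (\<lambda>t::real. u (z + t *\<^sub>R v)) differentiable (at 0)) \<and>
     continuous_on S (dir_deriv v u))"

text \<open>Intended for open sets only. The directions \<^term>\<open>1::complex\<close> and \<^term>\<open>\<i>\<close> give the partial
  derivatives with respect to $x$ and $y$.\<close>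

definition C2_on :: "complex set \<Rightarrow> (complex \<Rightarrow> real) \<Rightarrow> bool" where
  "C2_on S u \<longleftrightarrow> C1_on S u \<and> (\<forall>v\<in>{1, \<i>}. C1_on S (dir_deriv v u))"

definition laplacian :: "(complex \<Rightarrow> real) \<Rightarrow> complex \<Rightarrow> real" where
  "laplacian u z = dir_deriv 1 (dir_deriv 1 u) z + dir_deriv \<i> (dir_deriv \<i> u) z"

definition conformal_pseudometric :: "complex set \<Rightarrow> (complex \<Rightarrow> real) \<Rightarrow> bool" where
  "conformal_pseudometric G l \<longleftrightarrow>
     open G \<and> connected G \<and> G \<noteq> {} \<and>
     continuous_on G l \<and> (\<forall>z\<in>G. 0 \<le> l z) \<and> C2_on {z\<in>G. 0 < l z} l"

text \<open>Meaningful only where the density is positive.\<close>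

definition curvature :: "(complex \<Rightarrow> real) \<Rightarrow> complex \<Rightarrow> real" where
  "curvature l z = - laplacian (\<lambda>w. ln (l w)) z / (l z)\<^sup>2"

text \<open>The curvature inequality in the following relation is required wherever both curvatures are
  defined. The second condition forces \<open>l \<le> m\<close>, so these are exactly the points with \<open>0 < l z\<close>.\<close>

definition pseudometric_le ::
    "complex set \<Rightarrow> (complex \<Rightarrow> real) \<Rightarrow> (complex \<Rightarrow> real) \<Rightarrow> bool" where
  "pseudometric_le G l m \<longleftrightarrow>
     (\<forall>z\<in>G. 0 < l z \<and> 0 < m z \<longrightarrow> curvature l z \<le> curvature m z) \<and>
     discrete {z\<in>G. m z = 0} \<and>
     (\<exists>h. continuous_on G h \<and> (\<forall>z\<in>G. h z \<in> {0..1}) \<and>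
          (\<forall>z\<in>G. m z \<noteq> 0 \<longrightarrow> h z = l z / m z))"

text \<open>The value of the continuous extension of the quotient; see \<open>quotient_ext_eq\<close> below.\<close>

definition quotient_ext :: "(complex \<Rightarrow> real) \<Rightarrow> (complex \<Rightarrow> real) \<Rightarrow> complex \<Rightarrow> real" where
  "quotient_ext l m z = (if m z \<noteq> 0 then l z / m z else Lim (at z) (\<lambda>w. l w / m w))"

definition elog :: "real \<Rightarrow> ereal" where
  "elog x = (if x = 0 then -\<infinity> else ereal (ln x))"

definition locally_Hoelder_on :: "complex set \<Rightarrow> (complex \<Rightarrow> real) \<Rightarrow> bool" where
  "locally_Hoelder_on S f \<longleftrightarrow> (\<forall>z\<in>S. \<exists>e>0. \<exists>\<alpha>\<in>{0<..1}. \<exists>L.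
     \<forall>x\<in>S \<inter> ball z e. \<forall>y\<in>S \<inter> ball z e. \<bar>f x - f y\<bar> \<le> L * dist x y powr \<alpha>)"

lemma quotient_ext_eq:
  assumes G: "open G" and disc: "discrete {z\<in>G. m z = 0}"
    and h: "continuous_on G h" "\<And>z. z \<in> G \<Longrightarrow> m z \<noteq> 0 \<Longrightarrow> h z = l z / m z"
    and z: "z \<in> G"
  shows "quotient_ext l m z = h z"
proof (cases "m z = 0")
  case True
  with disc z obtain T where T: "open T" "T \<inter> {z\<in>G. m z = 0} = {z}"
    unfolding discrete_def isolated_in_def by blast
  have "eventually (\<lambda>w. w \<in> T \<inter> G) (at z)"
    using T G z by (intro eventually_at_in_open') auto
  moreover have "eventually (\<lambda>w. w \<noteq> z) (at z)"
    by (simp add: eventually_at_filter)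
  ultimately have ev: "eventually (\<lambda>w. h w = l w / m w) (at z)"
    by eventually_elim (use T(2) h(2) in blast)
  have "(h \<longlongrightarrow> h z) (at z)"
    using h(1) G z continuous_on_eq_continuous_at isContD by blast
  then have "((\<lambda>w. l w / m w) \<longlongrightarrow> h z) (at z)"
    using ev by (rule Lim_transform_eventually)
  then have "Lim (at z) (\<lambda>w. l w / m w) = h z"
    by (intro tendsto_Lim) auto
  with True show ?thesis
    by (simp add: quotient_ext_def)
qed (use h z in \<open>simp add: quotient_ext_def\<close>)

text \<open>Hence the supremum of \<open>elog (quotient_ext l m \<xi>)\<close> over a circle is a maximum.\<close>

lemma SUP_elog_quotient_ext_attained:
  assumes "open G" "pseudometric_le G l m" "compact K" "K \<noteq> {}" "K \<subseteq> G"
  shows "\<exists>\<xi>\<in>K. (SUP \<zeta>\<in>K. elog (quotient_ext l m \<zeta>)) = elog (quotient_ext l m \<xi>)"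
proof -
  obtain h where disc: "discrete {z\<in>G. m z = 0}" and h: "continuous_on G h"
      "\<And>z. z \<in> G \<Longrightarrow> h z \<in> {0..1}" "\<And>z. z \<in> G \<Longrightarrow> m z \<noteq> 0 \<Longrightarrow> h z = l z / m z"
    using assms(2) unfolding pseudometric_le_def by blast
  have eq: "quotient_ext l m z = h z" if "z \<in> G" for z
    using quotient_ext_eq[OF assms(1) disc h(1,3) that] by blast
  obtain \<xi> where \<xi>: "\<xi> \<in> K" "\<And>\<zeta>. \<zeta> \<in> K \<Longrightarrow> h \<zeta> \<le> h \<xi>"
    using continuous_attains_sup[OF assms(3,4) continuous_on_subset[OF h(1) assms(5)]] by blast
  have "elog (quotient_ext l m \<zeta>) \<le> elog (quotient_ext l m \<xi>)" if "\<zeta> \<in> K" for \<zeta>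
  proof -
    have "0 \<le> h \<zeta>" "0 \<le> h \<xi>" "h \<zeta> \<le> h \<xi>"
      using h(2)[of \<zeta>] h(2)[of \<xi>] \<xi> that assms(5) by auto
    moreover have "quotient_ext l m \<zeta> = h \<zeta>" "quotient_ext l m \<xi> = h \<xi>"
      using eq that \<xi>(1) assms(5) by auto
    ultimately show ?thesis
      by (auto simp: elog_def)
  qed
  then have "(SUP \<zeta>\<in>K. elog (quotient_ext l m \<zeta>)) = elog (quotient_ext l m \<xi>)"
    using \<xi>(1) by (intro antisym SUP_least SUP_upper)
  with \<xi>(1) show ?thesis by blast
qed

end

theory Submission
  imports Defs
begin

text \<open>On a disk of radius $R$ about $q$ contained in the unit disk, Ahlfors' lemma bounds \<open>\<mu>\<close> by
  $R/(R^2-|z-q|^2)$, so the logarithm $u \le 0$ of the quotient satisfies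
  $\Delta u \ge 2c\,u\,R^2/(R^2-|z-q|^2)^2$ away from the zeros of \<open>\<mu>\<close>, which are removable for the
  maximum principle. Comparing $u$ on an annulus with the radial barriers $(\log(R^2/|z-q|^2))^{c/2}$
  and, if $c$ is large, $(R^2-|z-q|^2)^{c/2}$ gives the decay estimate for $q = 0$, $R \to 1$.
  On small disks the same comparison shows that the set where the quotient equals 1 is open.\<close>

section \<open>Second derivatives along lines\<close>

text \<open>The difficulty is a constant that depends on r but not on c. For a barrier of order (R -
  |z|)^a near the outer circle, the leading terms of the differential inequality require 4 a (a - 1)
  \<ge> 2 c. With a = c/2 this reads a \<ge> 2, that is c \<ge> 4, which is forced by -c \<le>
  \<kappa> \<le> -4. At c = 4 there is equality, so lower-order terms decide: the power barrier
  loses, and is admissible only if c is large relative to the inner radius. The logarithmic barrier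
  always works, but rewriting it in powers of (1 - |z|^2)/(1 - r^2) costs the factor ((1 -
  r^2)/log(1/r^2))^(c/2), which tends to 0 as c grows. It serves for the bounded range of c that the
  power barrier leaves open.

  A second obstacle is that the logarithm of the quotient is -infinity at zeros of \<open>l\<close>.
  The function actually maximised is log max(p, 1), where p is the quotient divided by the claimed
  bound: it is continuous, positive exactly where the bound is violated, and has a Laplacian there
  off the zeros of \<open>\<mu>\<close>.\<close>

definition has_second_deriv :: "complex \<Rightarrow> (complex \<Rightarrow> real) \<Rightarrow> complex \<Rightarrow> real \<Rightarrow> bool" where
  "has_second_deriv v F z L \<longleftrightarrow>
     (\<exists>F'. (\<forall>\<^sub>F t in nhds 0. ((\<lambda>s. F (z + s *\<^sub>R v)) has_real_derivative F' t) (at t)) \<and>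
       (F' has_real_derivative L) (at 0))"

lemma has_second_derivI:
  assumes "\<forall>\<^sub>F t in nhds 0. ((\<lambda>s. F (z + s *\<^sub>R v)) has_real_derivative F' t) (at t)"
    and "(F' has_real_derivative L) (at 0)"
  shows "has_second_deriv v F z L"
  using assms unfolding has_second_deriv_def by blast

lemma eventually_along_line:
  assumes "\<forall>\<^sub>F w in nhds z. P w"
  shows "\<forall>\<^sub>F t in nhds (0::real). P (z + t *\<^sub>R (v::complex))"
proof -
  have "((\<lambda>t. z + t *\<^sub>R v) \<longlongrightarrow> z + 0 *\<^sub>R v) (nhds (0::real))"
    by (intro tendsto_intros filterlim_ident)
  then have "filterlim (\<lambda>t. z + t *\<^sub>R v) (nhds z) (nhds (0::real))"
    by simp
  then show ?thesis
    using assms by (rule eventually_compose_filterlim[rotated])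
qed

lemma has_second_deriv_cong:
  assumes "has_second_deriv v F z L" "\<forall>\<^sub>F w in nhds z. F w = G w"
  shows "has_second_deriv v G z L"
proof -
  obtain F' where F': "\<forall>\<^sub>F t in nhds 0. ((\<lambda>s. F (z + s *\<^sub>R v)) has_real_derivative F' t) (at t)"
      "(F' has_real_derivative L) (at 0)"
    using assms(1) unfolding has_second_deriv_def by blast
  \<comment> \<open>Agreement at the single parameter 0 would not do: the first derivative must be
    transferred at every small t, so agreement is needed on a neighbourhood of each such t.\<close>
  have "\<forall>\<^sub>F t in nhds 0. \<forall>\<^sub>F s in nhds t. F (z + s *\<^sub>R v) = G (z + s *\<^sub>R v)"
    unfolding eventually_eventually by (rule eventually_along_line[OF assms(2)])
  with F'(1) have "\<forall>\<^sub>F t in nhds 0. ((\<lambda>s. G (z + s *\<^sub>R v)) has_real_derivative F' t) (at t)"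
    by eventually_elim (rule iffD1[OF DERIV_cong_ev[OF refl _ refl]])
  with F'(2) show ?thesis
    by (rule has_second_derivI[rotated])
qed

lemma has_second_deriv_add:
  assumes "has_second_deriv v F z A" "has_second_deriv v G z B"
  shows "has_second_deriv v (\<lambda>w. F w + G w) z (A + B)"
proof -
  obtain F' G' where
      F': "\<forall>\<^sub>F t in nhds 0. ((\<lambda>s. F (z + s *\<^sub>R v)) has_real_derivative F' t) (at t)"
      "(F' has_real_derivative A) (at 0)"
      and G': "\<forall>\<^sub>F t in nhds 0. ((\<lambda>s. G (z + s *\<^sub>R v)) has_real_derivative G' t) (at t)"
      "(G' has_real_derivative B) (at 0)"
    using assms unfolding has_second_deriv_def by blast
  show ?thesis
  proof (rule has_second_derivI)
    show "\<forall>\<^sub>F t in nhds 0.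
        ((\<lambda>s. F (z + s *\<^sub>R v) + G (z + s *\<^sub>R v)) has_real_derivative F' t + G' t) (at t)"
      using F'(1) G'(1) by eventually_elim (rule DERIV_add)
    show "((\<lambda>t. F' t + G' t) has_real_derivative A + B) (at 0)"
      using F'(2) G'(2) by (rule DERIV_add)
  qed
qed

lemma has_second_deriv_cmult:
  assumes "has_second_deriv v F z A"
  shows "has_second_deriv v (\<lambda>w. k * F w) z (k * A)"
proof -
  obtain F' where
      F': "\<forall>\<^sub>F t in nhds 0. ((\<lambda>s. F (z + s *\<^sub>R v)) has_real_derivative F' t) (at t)"
      "(F' has_real_derivative A) (at 0)"
    using assms unfolding has_second_deriv_def by blast
  show ?thesis
  proof (rule has_second_derivI)
    show "\<forall>\<^sub>F t in nhds 0. ((\<lambda>s. k * F (z + s *\<^sub>R v)) has_real_derivative k * F' t) (at t)"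
      using F'(1) by eventually_elim (rule DERIV_cmult)
    show "((\<lambda>t. k * F' t) has_real_derivative k * A) (at 0)"
      using F'(2) by (rule DERIV_cmult)
  qed
qed

lemma has_second_deriv_const: "has_second_deriv v (\<lambda>w. k) z 0"
  by (rule has_second_derivI[where F' = "\<lambda>_. 0"]) auto

text \<open>The value \<open>B\<close> may stay unnamed, because
  \<open>has_second_deriv_imp_dir_deriv\<close> identifies any such value with the iterated
  directional derivative.\<close>

lemma has_second_deriv_ln:
  assumes "has_second_deriv v F z A" "\<forall>\<^sub>F w in nhds z. 0 < F w"
  shows "\<exists>B. has_second_deriv v (\<lambda>w. ln (F w)) z B"
proof -
  obtain F' where
      F': "\<forall>\<^sub>F t in nhds 0. ((\<lambda>s. F (z + s *\<^sub>R v)) has_real_derivative F' t) (at t)"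
      "(F' has_real_derivative A) (at 0)"
    using assms unfolding has_second_deriv_def by blast
  have pos: "0 < F z"
    using assms(2) by (rule eventually_nhds_x_imp_x)
  have F0: "((\<lambda>s. F (z + s *\<^sub>R v)) has_real_derivative F' 0) (at 0)"
    using F'(1) by (rule eventually_nhds_x_imp_x)
  have "has_second_deriv v (\<lambda>w. ln (F w)) z ((A * F z - F' 0 * F' 0) / (F z * F z))"
  proof (rule has_second_derivI)
    show "\<forall>\<^sub>F t in nhds 0. ((\<lambda>s. ln (F (z + s *\<^sub>R v))) has_real_derivative
        F' t / F (z + t *\<^sub>R v)) (at t)"
      using F'(1) eventually_along_line[OF assms(2), of v]
      by eventually_elim (auto intro!: derivative_eq_intros)
    show "((\<lambda>t. F' t / F (z + t *\<^sub>R v)) has_real_derivative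
        (A * F z - F' 0 * F' 0) / (F z * F z)) (at 0)"
      using DERIV_divide[OF F'(2) F0] pos by simp
  qed
  then show ?thesis ..
qed

lemma dir_deriv_eqI:
  assumes "((\<lambda>s. F (z + s *\<^sub>R v)) has_real_derivative D) (at t)"
  shows "dir_deriv v F (z + t *\<^sub>R v) = D"
proof -
  have "((\<lambda>s. F (z + (s + t) *\<^sub>R v)) has_real_derivative D) (at 0)"
    using DERIV_shift[of "\<lambda>s. F (z + s *\<^sub>R v)" D 0 t] assms by simp
  then have "((\<lambda>s. F (z + t *\<^sub>R v + s *\<^sub>R v)) has_real_derivative D) (at 0)"
    by (simp add: scaleR_add_left add_ac)
  then show ?thesis
    unfolding dir_deriv_def by (rule DERIV_imp_deriv)
qed

lemma has_second_deriv_imp_dir_deriv: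
  assumes "has_second_deriv v F z L"
  shows "dir_deriv v (dir_deriv v F) z = L"
proof -
  obtain F' where
      F': "\<forall>\<^sub>F t in nhds 0. ((\<lambda>s. F (z + s *\<^sub>R v)) has_real_derivative F' t) (at t)"
      "(F' has_real_derivative L) (at 0)"
    using assms unfolding has_second_deriv_def by blast
  have "\<forall>\<^sub>F t in nhds 0. F' t = dir_deriv v F (z + t *\<^sub>R v)"
    using F'(1) by eventually_elim (simp add: dir_deriv_eqI)
  then have "((\<lambda>t. dir_deriv v F (z + t *\<^sub>R v)) has_real_derivative L) (at 0)"
    using F'(2) iffD1[OF DERIV_cong_ev[OF refl _ refl]] by fast
  from dir_deriv_eqI[OF this] show ?thesis by simp
qed

text \<open>\<open>deriv\<close> has a value even where no derivative exists, so a maximum principle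
  cannot argue with \<open>dir_deriv\<close> alone. Here the regularity of the metrics is turned
  into genuine derivatives.\<close>

lemma C2_on_has_second_deriv:
  assumes "open S" "C2_on S u" "z \<in> S" "v \<in> {1, \<i>}"
  shows "has_second_deriv v u z (dir_deriv v (dir_deriv v u) z)"
proof (rule has_second_derivI)
  have d: "((\<lambda>t. f (w + t *\<^sub>R v)) has_real_derivative dir_deriv v f w) (at 0)"
    if "C1_on S f" "w \<in> S" for f w
  proof -
    have "(\<lambda>t. f (w + t *\<^sub>R v)) differentiable (at 0)"
      using that assms(4) unfolding C1_on_def by blast
    then show ?thesis
      unfolding dir_deriv_def
      by (metis DERIV_imp_deriv real_differentiable_def)
  qed
  have "C1_on S u" "C1_on S (dir_deriv v u)"
    using assms(2,4) unfolding C2_on_def by auto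
  note d1 = d[OF this(1)] and d2 = d[OF this(2)]
  have "\<forall>\<^sub>F w in nhds z. w \<in> S"
    using assms(1,3) by (rule eventually_nhds_in_open)
  from eventually_along_line[OF this, of v]
  show "\<forall>\<^sub>F t in nhds 0. ((\<lambda>s. u (z + s *\<^sub>R v)) has_real_derivative
      dir_deriv v u (z + t *\<^sub>R v)) (at t)"
  proof eventually_elim
    case (elim t)
    from d1[OF this] have "((\<lambda>s. u (z + (s + t) *\<^sub>R v)) has_real_derivative
        dir_deriv v u (z + t *\<^sub>R v)) (at 0)"
      by (simp add: scaleR_add_left add_ac)
    then show ?case
      using DERIV_shift[of "\<lambda>s. u (z + s *\<^sub>R v)" _ 0 t] by simp
  qed
  show "((\<lambda>t. dir_deriv v u (z + t *\<^sub>R v)) has_real_derivative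
      dir_deriv v (dir_deriv v u) z) (at 0)"
    using d2[OF assms(3)] .
qed

text \<open>If \<open>L\<close> were positive, then g' would vanish at 0 and be positive just to the
  right of it, so by the mean value theorem g would exceed g 0 there. The argument uses the
  derivative of g' only at the single point 0.\<close>

lemma second_deriv_nonpos_at_local_max:
  fixes g :: "real \<Rightarrow> real"
  assumes g: "\<forall>\<^sub>F t in nhds 0. (g has_real_derivative g' t) (at t)"
    and g': "(g' has_real_derivative L) (at 0)"
    and max: "\<forall>\<^sub>F t in nhds 0. g t \<le> g 0"
  shows "L \<le> 0"
proof (rule ccontr)
  assume "\<not> L \<le> 0"
  then have L: "0 < L" by simp
  obtain d where d: "0 < d" "\<And>t. \<bar>t\<bar> < d \<Longrightarrow> (g has_real_derivative g' t) (at t)"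
      "\<And>t. \<bar>t\<bar> < d \<Longrightarrow> g t \<le> g 0"
    using eventually_conj[OF g max] unfolding eventually_nhds_metric dist_real_def by auto
  have "g' 0 = 0"
    using DERIV_local_max[OF d(2)[of 0] d(1)] d(1,3) by simp
  then obtain e where e: "0 < e" "\<And>t. 0 < t \<Longrightarrow> t < e \<Longrightarrow> 0 < g' t"
    using DERIV_pos_inc_right[OF g' L] by auto
  define t where "t = min d e / 2"
  have t: "0 < t" "t < d" "t < e"
    using d(1) e(1) by (auto simp: t_def min_def)
  obtain s where s: "0 < s" "s < t" "g t - g 0 = (t - 0) * g' s"
    using MVT2[of 0 t g g'] t d(2) by force
  have "0 < t * g' s"
    using t s e(2)[of s] by simp
  then show False
    using s(3) d(3)[of t] t by simp
qed

lemma has_second_deriv_local_max: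
  assumes "has_second_deriv v F z L" "\<forall>\<^sub>F w in nhds z. F w \<le> F z"
  shows "L \<le> 0"
proof -
  obtain F' where
      F': "\<forall>\<^sub>F t in nhds 0. ((\<lambda>s. F (z + s *\<^sub>R v)) has_real_derivative F' t) (at t)"
      "(F' has_real_derivative L) (at 0)"
    using assms unfolding has_second_deriv_def by blast
  show ?thesis
    using second_deriv_nonpos_at_local_max[OF F'] eventually_along_line[OF assms(2), of v] by simp
qed

text \<open>Along a unit direction the squared distance to \<open>q\<close> is a quadratic
  polynomial X with X'(0) = 2 ((z - q) \<bullet> v) and X'' = 2; the chain rule does the rest.
  Squaring the norm keeps X smooth also at z = q.\<close>

lemma has_second_deriv_radial:
  assumes \<phi>: "\<forall>\<^sub>F x in nhds ((norm (z - q))\<^sup>2). (\<phi> has_real_derivative \<phi>' x) (at x)"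
    and \<phi>': "(\<phi>' has_real_derivative D) (at ((norm (z - q))\<^sup>2))"
    and v: "norm v = 1"
  shows "has_second_deriv v (\<lambda>w. \<phi> ((norm (w - q))\<^sup>2)) z
    (4 * ((z - q) \<bullet> v)\<^sup>2 * D + 2 * \<phi>' ((norm (z - q))\<^sup>2))"
proof (rule has_second_derivI)
  let ?X = "\<lambda>t::real. (norm (z + t *\<^sub>R v - q))\<^sup>2"
  let ?X' = "\<lambda>t::real. 2 * ((z - q) \<bullet> v) + 2 * t"
  have X: "?X t = (norm (z - q))\<^sup>2 + 2 * t * ((z - q) \<bullet> v) + t\<^sup>2" for t
  proof -
    have "?X t = (z - q + t *\<^sub>R v) \<bullet> (z - q + t *\<^sub>R v)"
      by (simp add: power2_norm_eq_inner algebra_simps)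
    also have "\<dots> = (norm (z - q))\<^sup>2 + 2 * t * ((z - q) \<bullet> v) + t\<^sup>2 * (norm v)\<^sup>2"
      unfolding power2_norm_eq_inner
      by (simp add: inner_add_left inner_add_right inner_commute power2_eq_square)
    finally show ?thesis using v by simp
  qed
  have dX: "(?X has_real_derivative ?X' t) (at t)" for t
    unfolding X by (auto intro!: derivative_eq_intros)
  have "(?X \<longlongrightarrow> ?X 0) (nhds 0)"
    by (intro tendsto_intros filterlim_ident)
  then have "filterlim ?X (nhds ((norm (z - q))\<^sup>2)) (nhds 0)"
    by simp
  from eventually_compose_filterlim[OF \<phi> this]
  show "\<forall>\<^sub>F t in nhds 0. ((\<lambda>s. \<phi> (?X s)) has_real_derivative \<phi>' (?X t) * ?X' t) (at t)"
    by eventually_elim (rule DERIV_chain2[OF _ dX])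
  have "((\<lambda>t. \<phi>' (?X t)) has_real_derivative D * ?X' 0) (at 0)"
    by (rule DERIV_chain2[OF _ dX]) (use \<phi>' in simp)
  moreover have "(?X' has_real_derivative 2) (at 0)"
    by (auto intro!: derivative_eq_intros)
  ultimately have "((\<lambda>t. \<phi>' (?X t) * ?X' t) has_real_derivative
      D * ?X' 0 * ?X' 0 + 2 * \<phi>' (?X 0)) (at 0)"
    by (rule DERIV_mult)
  then show "((\<lambda>t. \<phi>' (?X t) * ?X' t) has_real_derivative
      4 * ((z - q) \<bullet> v)\<^sup>2 * D + 2 * \<phi>' ((norm (z - q))\<^sup>2)) (at 0)"
    by (simp add: power2_eq_square mult_ac)
qed

section \<open>The Laplacian as a sum of two second derivatives along lines\<close>

definition has_laplacian :: "(complex \<Rightarrow> real) \<Rightarrow> complex \<Rightarrow> real \<Rightarrow> bool" where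
  "has_laplacian F z L \<longleftrightarrow>
     (\<exists>A B. has_second_deriv 1 F z A \<and> has_second_deriv \<i> F z B \<and> L = A + B)"

lemma has_laplacian_cong:
  assumes "has_laplacian F z L" "\<forall>\<^sub>F w in nhds z. F w = G w"
  shows "has_laplacian G z L"
  using assms has_second_deriv_cong unfolding has_laplacian_def by blast

lemma has_laplacian_add:
  assumes "has_laplacian F z A" "has_laplacian G z B"
  shows "has_laplacian (\<lambda>w. F w + G w) z (A + B)"
proof -
  obtain A1 A2 B1 B2 where *: "has_second_deriv 1 F z A1" "has_second_deriv \<i> F z A2" "A = A1 + A2"
    "has_second_deriv 1 G z B1" "has_second_deriv \<i> G z B2" "B = B1 + B2"
    using assms unfolding has_laplacian_def by blast
  show ?thesis
    unfolding has_laplacian_def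
    by (intro exI[of _ "A1 + B1"] exI[of _ "A2 + B2"] conjI has_second_deriv_add *) (simp add: *)
qed

lemma has_laplacian_cmult:
  assumes "has_laplacian F z A"
  shows "has_laplacian (\<lambda>w. k * F w) z (k * A)"
  using assms has_second_deriv_cmult[of _ F z _ k] unfolding has_laplacian_def
  by (metis distrib_left)

lemma has_laplacian_const: "has_laplacian (\<lambda>w. k) z 0"
  using has_second_deriv_const unfolding has_laplacian_def by fastforce

lemma has_laplacian_diff:
  assumes "has_laplacian F z A" "has_laplacian G z B"
  shows "has_laplacian (\<lambda>w. F w - G w) z (A - B)"
  using has_laplacian_add[OF assms(1) has_laplacian_cmult[OF assms(2), of "-1"]] by simp

lemma has_laplacian_ln:
  assumes "open S" "C2_on S u" "z \<in> S" "\<And>w. w \<in> S \<Longrightarrow> 0 < u w"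
  shows "has_laplacian (\<lambda>w. ln (u w)) z (laplacian (\<lambda>w. ln (u w)) z)"
proof -
  have ev: "\<forall>\<^sub>F w in nhds z. 0 < u w"
    using eventually_nhds_in_open[OF assms(1,3)] by eventually_elim (rule assms(4))
  have "has_second_deriv v (\<lambda>w. ln (u w)) z (dir_deriv v (dir_deriv v (\<lambda>w. ln (u w))) z)"
    if "v \<in> {1, \<i>}" for v
    using has_second_deriv_ln[OF C2_on_has_second_deriv[OF assms(1-3) that] ev]
      has_second_deriv_imp_dir_deriv by blast
  then show ?thesis
    unfolding has_laplacian_def laplacian_def by blast
qed

lemma has_laplacian_local_max:
  assumes "has_laplacian F z L" "\<forall>\<^sub>F w in nhds z. F w \<le> F z"
  shows "L \<le> 0"
  using assms(1) has_second_deriv_local_max[OF _ assms(2)] unfolding has_laplacian_def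
  by (metis add_nonpos_nonpos)

text \<open>The squares of the components of z - q along 1 and \<i> add up to |z - q|^2, so a radial
  function reduces every later barrier inequality to one real variable x = |z - q|^2.\<close>

lemma has_laplacian_radial:
  assumes \<phi>: "\<forall>\<^sub>F x in nhds ((norm (z - q))\<^sup>2). (\<phi> has_real_derivative \<phi>' x) (at x)"
    and \<phi>': "(\<phi>' has_real_derivative D) (at ((norm (z - q))\<^sup>2))"
  shows "has_laplacian (\<lambda>w. \<phi> ((norm (w - q))\<^sup>2)) z
    (4 * ((norm (z - q))\<^sup>2 * D + \<phi>' ((norm (z - q))\<^sup>2)))"
proof -
  have "4 * ((norm (z - q))\<^sup>2 * D + y) =
      (4 * ((z - q) \<bullet> 1)\<^sup>2 * D + 2 * y) + (4 * ((z - q) \<bullet> \<i>)\<^sup>2 * D + 2 * y)" for y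
    by (simp add: cmod_power2 inner_complex_def algebra_simps)
  moreover have "has_second_deriv v (\<lambda>w. \<phi> ((norm (w - q))\<^sup>2)) z
      (4 * ((z - q) \<bullet> v)\<^sup>2 * D + 2 * \<phi>' ((norm (z - q))\<^sup>2))" if "v \<in> {1, \<i>}" for v
    using that by (intro has_second_deriv_radial[OF assms]) auto
  ultimately show ?thesis
    unfolding has_laplacian_def by blast
qed

section \<open>Maximum principle with isolated exceptional points\<close>

text \<open>A positive maximum lies in \<open>W\<close> by the boundary condition, and the Laplacian
  there would be both positive and nonpositive. Asking for a Laplacian only where \<open>f\<close>
  is positive suits functions log max(p, 1), which may fail to be differentiable where p =
  1.\<close>

lemma maximum_principle:
  fixes f :: "complex \<Rightarrow> real"
  assumes K: "compact K" "continuous_on K f" and W: "open W" "W \<subseteq> K"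
    and boundary: "\<And>z. z \<in> K - W \<Longrightarrow> f z \<le> 0"
    and sub: "\<And>z. z \<in> W \<Longrightarrow> 0 < f z \<Longrightarrow> \<exists>L>0. has_laplacian f z L"
    and z: "z \<in> K"
  shows "f z \<le> 0"
proof (rule ccontr)
  assume "\<not> f z \<le> 0"
  obtain p where p: "p \<in> K" "\<And>w. w \<in> K \<Longrightarrow> f w \<le> f p"
    using continuous_attains_sup[OF K(1) _ K(2)] z by blast
  have fp: "0 < f p"
    using p(2)[OF z] \<open>\<not> f z \<le> 0\<close> by simp
  then have "p \<in> W"
    using boundary[of p] p(1) by force
  then obtain L where L: "0 < L" "has_laplacian f p L"
    using sub fp by blast
  have "\<forall>\<^sub>F w in nhds p. w \<in> W"
    using W(1) \<open>p \<in> W\<close> by (rule eventually_nhds_in_open)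
  then have "\<forall>\<^sub>F w in nhds p. f w \<le> f p"
    by eventually_elim (use p(2) W(2) in blast)
  from has_laplacian_local_max[OF L(2) this] L(1) show False by simp
qed

lemma has_laplacian_ln_dist:
  assumes "z \<noteq> q"
  shows "has_laplacian (\<lambda>w. ln ((norm (w - q))\<^sup>2)) z 0"
proof -
  let ?x = "(norm (z - q))\<^sup>2"
  have x: "0 < ?x" using assms by simp
  have "\<forall>\<^sub>F x in nhds ?x. x \<in> {0<..}"
    by (rule eventually_nhds_in_open) (use x in auto)
  then have "\<forall>\<^sub>F x in nhds ?x. (ln has_real_derivative 1 / x) (at x)"
    by eventually_elim (auto intro!: derivative_eq_intros)
  moreover have "((\<lambda>x. 1 / x) has_real_derivative - 1 / (?x * ?x)) (at ?x)"
    using x by (auto intro!: derivative_eq_intros)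
  ultimately have "has_laplacian (\<lambda>w. ln ((norm (w - q))\<^sup>2)) z (4 * (?x * (- 1 / (?x * ?x)) + 1 / ?x))"
    by (rule has_laplacian_radial)
  moreover have "4 * (?x * (- 1 / (?x * ?x)) + 1 / ?x) = 0"
    using x by (simp add: field_simps)
  ultimately show ?thesis by simp
qed

text \<open>The harmonic function \<open>ln (norm (w - p))\<close> tends to $-\infty$ at \<open>p\<close>, so a small multiple of it
  removes the singularity.\<close>

lemma bounded_near_isolated_singularity:
  fixes f :: "complex \<Rightarrow> real"
  assumes f: "continuous_on (cball p \<delta>) f"
    and bound: "\<And>w. w \<in> cball p \<delta> \<Longrightarrow> f w \<le> F"
    and sphere: "\<And>w. w \<in> sphere p \<delta> \<Longrightarrow> f w \<le> m" and m: "0 \<le> m" "m \<le> F"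
    and sub: "\<And>w. w \<in> ball p \<delta> - {p} \<Longrightarrow> 0 < f w \<Longrightarrow> \<exists>L>0. has_laplacian f w L"
    and w: "w \<in> cball p \<delta> - {p}"
  shows "f w \<le> m"
proof -
  have \<delta>: "0 < \<delta>"
    using w by (metis DiffE cball_eq_empty cball_trivial empty_iff linorder_less_linear singletonI)
  \<comment> \<open>Twice the logarithm of |x - p|/\<delta>: harmonic off \<open>p\<close>, zero on
    the outer circle, nonpositive inside.\<close>
  define l where "l x = ln ((norm (x - p))\<^sup>2) - ln (\<delta>\<^sup>2)" for x
  have l_nonpos: "l x \<le> 0" if "x \<in> cball p \<delta> - {p}" for x
  proof -
    have "(norm (x - p))\<^sup>2 \<le> \<delta>\<^sup>2" "0 < (norm (x - p))\<^sup>2"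
      using that \<delta> by (auto simp: dist_norm norm_minus_commute intro!: power_mono)
    then show ?thesis
      unfolding l_def using \<delta> ln_le_cancel_iff[of "(norm (x - p))\<^sup>2" "\<delta>\<^sup>2"] by simp
  qed
  have key: "f w + \<epsilon> * l w \<le> m" if \<epsilon>: "0 < \<epsilon>" for \<epsilon>
  proof -
    \<comment> \<open>The inner radius is so small that \<epsilon> * l is at most m - F on the inner
      circle, which makes up for the crude bound \<open>F\<close> on f; the minimum keeps
      \<open>w\<close> inside the annulus.\<close>
    define \<eta> where "\<eta> = min (norm (w - p)) (\<delta> * exp ((m - F) / (2 * \<epsilon>)))"
    have \<eta>: "0 < \<eta>" "\<eta> \<le> norm (w - p)" "\<eta> \<le> \<delta> * exp ((m - F) / (2 * \<epsilon>))"
      using w \<delta> by (auto simp: \<eta>_def)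
    define A where "A = cball p \<delta> - ball p \<eta>"
    define V where "V = ball p \<delta> - cball p \<eta>"
    have A: "x \<in> cball p \<delta> - {p}" if "x \<in> A" for x
      using that \<eta>(1) by (auto simp: A_def)
    have "(f w + \<epsilon> * l w) - m \<le> 0"
    proof (rule maximum_principle[where f = "\<lambda>x. (f x + \<epsilon> * l x) - m" and K = A and W = V])
      show "compact A"
        unfolding A_def by (intro compact_diff) auto
      have "continuous_on A f"
        using f by (rule continuous_on_subset) (auto simp: A_def)
      moreover have "continuous_on A l"
        unfolding l_def using A by (intro continuous_intros) auto
      ultimately show "continuous_on A (\<lambda>x. (f x + \<epsilon> * l x) - m)"
        by (intro continuous_intros)
      show "open V" "V \<subseteq> A" "w \<in> A"
        using w \<eta>(2) by (auto simp: V_def A_def dist_norm norm_minus_commute)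
    next
      fix x assume x: "x \<in> A - V"
      then consider "dist p x = \<delta>" | "dist p x = \<eta>"
        by (auto simp: A_def V_def)
      then show "(f x + \<epsilon> * l x) - m \<le> 0"
      proof cases
        case 1
        then have "l x = 0" "f x \<le> m"
          using sphere[of x] by (auto simp: l_def dist_norm norm_minus_commute)
        then show ?thesis by simp
      next
        case 2
        have "l x = 2 * (ln \<eta> - ln \<delta>)"
          using 2 \<eta>(1) \<delta> by (simp add: l_def ln_realpow dist_norm norm_minus_commute)
        moreover have "ln \<eta> \<le> ln (\<delta> * exp ((m - F) / (2 * \<epsilon>)))"
          using \<eta>(1,3) by simp
        moreover have "\<dots> = ln \<delta> + (m - F) / (2 * \<epsilon>)"
          using \<delta> by (simp add: ln_mult)
        ultimately have "l x \<le> (m - F) / \<epsilon>"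
          by simp
        then have "\<epsilon> * l x \<le> m - F"
          using \<epsilon> by (simp add: field_simps)
        moreover have "f x \<le> F"
          using x by (intro bound) (auto simp: A_def)
        ultimately show ?thesis by simp
      qed
    next
      fix x assume x: "x \<in> V" "0 < (f x + \<epsilon> * l x) - m"
      have xp: "x \<noteq> p" "x \<in> ball p \<delta> - {p}"
        using x(1) \<eta>(1) by (auto simp: V_def)
      \<comment> \<open>Neither \<epsilon> * l nor -m is positive, so positivity of the modified
        function passes to \<open>f\<close>, where \<open>sub\<close> applies.\<close>
      have "\<epsilon> * l x \<le> 0"
        using l_nonpos[of x] xp \<epsilon> by (simp add: mult_le_0_iff)
      then have "0 < f x"
        using x(2) m(1) by linarith
      with sub xp(2) obtain L where L: "0 < L" "has_laplacian f x L"
        by blast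
      have "has_laplacian (\<lambda>x. (f x + \<epsilon> * l x) - m) x ((L + \<epsilon> * (0 - 0)) - 0)"
        unfolding l_def using xp(1) L(2)
        by (intro has_laplacian_diff has_laplacian_add has_laplacian_cmult has_laplacian_const
              has_laplacian_ln_dist)
      with L(1) show "\<exists>L>0. has_laplacian (\<lambda>x. (f x + \<epsilon> * l x) - m) x L"
        by auto
    qed
    then show ?thesis by simp
  qed
  have "((\<lambda>\<epsilon>. f w + \<epsilon> * l w) \<longlongrightarrow> f w + 0 * l w) (at_right 0)"
    by (intro tendsto_intros)
  moreover have "\<forall>\<^sub>F \<epsilon> in at_right 0. f w + \<epsilon> * l w \<le> m"
    using eventually_at_right_less by eventually_elim (rule key)
  ultimately show ?thesis
    using tendsto_upperbound by force
qed

text \<open>Off \<open>Z\<close> a positive maximum is impossible as before. If it sat at an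
  isolated point p of \<open>Z\<close>, then \<open>f\<close> would be strictly smaller than f p on
  a small circle about p; the previous lemma carries that bound to the punctured disk, and
  continuity carries it to p.\<close>

lemma maximum_principle_isolated:
  fixes f :: "complex \<Rightarrow> real"
  assumes K: "compact K" "continuous_on K f" and W: "open W" "W \<subseteq> K"
    and boundary: "\<And>z. z \<in> K - W \<Longrightarrow> f z \<le> 0"
    and sub: "\<And>z. z \<in> W - Z \<Longrightarrow> 0 < f z \<Longrightarrow> \<exists>L>0. has_laplacian f z L"
    and isolated: "\<And>z. z \<in> W \<inter> Z \<Longrightarrow> \<exists>e>0. ball z e \<inter> Z \<subseteq> {z}"
    and z: "z \<in> K"
  shows "f z \<le> 0"
proof (rule ccontr)
  assume "\<not> f z \<le> 0"
  obtain p where p: "p \<in> K" "\<And>w. w \<in> K \<Longrightarrow> f w \<le> f p"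
    using continuous_attains_sup[OF K(1) _ K(2)] z by blast
  have fp: "0 < f p"
    using p(2)[OF z] \<open>\<not> f z \<le> 0\<close> by simp
  then have "p \<in> W"
    using boundary[of p] p(1) by force
  have no_max: "f w < f p" if w: "w \<in> W - Z" for w
  proof (rule ccontr)
    assume "\<not> f w < f p"
    with p(2)[of w] w W(2) have eq: "f w = f p" by force
    with sub[OF w] fp obtain L where L: "0 < L" "has_laplacian f w L" by auto
    have "\<forall>\<^sub>F x in nhds w. x \<in> W"
      using W(1) w by (intro eventually_nhds_in_open) auto
    then have "\<forall>\<^sub>F x in nhds w. f x \<le> f w"
      by eventually_elim (use p(2) W(2) eq in auto)
    from has_laplacian_local_max[OF L(2) this] L(1) show False by simp
  qed
  with \<open>p \<in> W\<close> have "p \<in> W \<inter> Z" by blast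
  from isolated[OF this] obtain e where e: "0 < e" "ball p e \<inter> Z \<subseteq> {p}" by blast
  have "open (W \<inter> ball p e)" "p \<in> W \<inter> ball p e"
    using W(1) \<open>p \<in> W\<close> e(1) by auto
  then obtain \<delta> where \<delta>: "0 < \<delta>" "cball p \<delta> \<subseteq> W \<inter> ball p e"
    using open_contains_cball by meson
  then have disk: "w \<in> W - Z" if "w \<in> cball p \<delta> - {p}" for w
    using that e(2) by blast
  have contf: "continuous_on (cball p \<delta>) f"
    using K(2) by (rule continuous_on_subset) (use \<delta>(2) W(2) in blast)
  have "sphere p \<delta> \<noteq> {}"
    using \<delta>(1) by simp
  moreover have "continuous_on (sphere p \<delta>) f"
    using contf by (rule continuous_on_subset) auto
  ultimately obtain s where s: "s \<in> sphere p \<delta>" "\<And>w. w \<in> sphere p \<delta> \<Longrightarrow> f w \<le> f s"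
    using continuous_attains_sup[of "sphere p \<delta>" f] by auto
  have "s \<in> cball p \<delta> - {p}"
    using s(1) \<delta>(1) by auto
  then have "f s < f p"
    using no_max disk by blast
  \<comment> \<open>The maximum with 0 provides the nonnegative bound that the previous lemma asks
    for, and stays below f p because f p is positive.\<close>
  define m where "m = max (f s) 0"
  have m: "0 \<le> m" "m < f p"
    using \<open>f s < f p\<close> fp by (auto simp: m_def)
  have le: "f w \<le> m" if "w \<in> cball p \<delta> - {p}" for w
  proof (rule bounded_near_isolated_singularity[OF contf _ _ m(1) less_imp_le[OF m(2)] _ that])
    show "f w \<le> f p" if "w \<in> cball p \<delta>" for w
      using that \<delta>(2) W(2) p(2) by blast
    show "f w \<le> m" if "w \<in> sphere p \<delta>" for w
      using s(2)[OF that] by (simp add: m_def)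
    show "\<exists>L>0. has_laplacian f w L" if "w \<in> ball p \<delta> - {p}" "0 < f w" for w
      using that by (intro sub disk) auto
  qed
  have "\<forall>\<^sub>F w in at p. w \<in> ball p \<delta> - {p}"
    using eventually_at_in_open[of "ball p \<delta>" p] \<delta>(1) by simp
  then have "\<forall>\<^sub>F w in at p. f w \<le> m"
    by eventually_elim (rule le, auto)
  moreover have "(f \<longlongrightarrow> f p) (at p)"
    using continuous_on_interior[OF contf, of p] \<delta>(1) by (simp add: isCont_def)
  ultimately have "f p \<le> m"
    using tendsto_upperbound by force
  with m(2) show False by simp
qed

section \<open>Comparison on disks\<close>

lemma conformal_pseudometric_open_pos:
  assumes "conformal_pseudometric G l"
  shows "open {z \<in> G. 0 < l z}"
proof -
  have "open (G \<inter> l -` {0<..})"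
    using assms by (intro continuous_open_preimage) (auto simp: conformal_pseudometric_def)
  moreover have "G \<inter> l -` {0<..} = {z \<in> G. 0 < l z}"
    by auto
  ultimately show ?thesis by simp
qed

lemma conformal_pseudometric_has_laplacian_ln:
  assumes "conformal_pseudometric G l" "z \<in> G" "0 < l z"
  shows "has_laplacian (\<lambda>w. ln (l w)) z (- curvature l z * (l z)\<^sup>2)"
proof -
  have "has_laplacian (\<lambda>w. ln (l w)) z (laplacian (\<lambda>w. ln (l w)) z)"
    by (rule has_laplacian_ln[OF conformal_pseudometric_open_pos[OF assms(1)]])
      (use assms in \<open>auto simp: conformal_pseudometric_def\<close>)
  then show ?thesis
    using assms(3) by (simp add: curvature_def)
qed

text \<open>Where log max(p, 1) is positive, p exceeds 1 on a neighbourhood and the truncation is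
  not felt. It only removes the poles of log p, leaving the positive values untouched.\<close>

lemma has_laplacian_ln_max:
  assumes "open W" "continuous_on W p" "z \<in> W" "0 < ln (max (p z) 1)"
    and "has_laplacian F z L" "\<And>w. w \<in> W \<Longrightarrow> 1 < p w \<Longrightarrow> F w = ln (p w)"
  shows "has_laplacian (\<lambda>w. ln (max (p w) 1)) z L"
proof (rule has_laplacian_cong[OF assms(5)])
  have "open (W \<inter> p -` {1<..})"
    using assms(1,2) by (intro continuous_open_preimage) auto
  moreover have "z \<in> W \<inter> p -` {1<..}"
    using assms(3,4) by (auto simp: max_def split: if_splits)
  ultimately have "\<forall>\<^sub>F w in nhds z. w \<in> W \<inter> p -` {1<..}"
    by (rule eventually_nhds_in_open)
  then show "\<forall>\<^sub>F w in nhds z. F w = ln (max (p w) 1)"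
    by eventually_elim (use assms(6) in auto)
qed

text \<open>Equivalently, R/(R^2 - |w - q|^2), the Poincare density of the disk, has curvature
  -4.\<close>

lemma has_laplacian_ln_diff_norm_sq:
  assumes "norm (z - q) < R"
  shows "has_laplacian (\<lambda>w. ln (R\<^sup>2 - (norm (w - q))\<^sup>2)) z (- 4 * (R / (R\<^sup>2 - (norm (z - q))\<^sup>2))\<^sup>2)"
proof -
  let ?x = "(norm (z - q))\<^sup>2"
  have x: "?x < R\<^sup>2" using assms by (simp add: power_strict_mono)
  have "\<forall>\<^sub>F x in nhds ?x. x \<in> {..<R\<^sup>2}"
    by (rule eventually_nhds_in_open) (use x in auto)
  then have "\<forall>\<^sub>F x in nhds ?x. ((\<lambda>x. ln (R\<^sup>2 - x)) has_real_derivative - 1 / (R\<^sup>2 - x)) (at x)"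
    by eventually_elim (auto intro!: derivative_eq_intros)
  moreover have "((\<lambda>x. - 1 / (R\<^sup>2 - x)) has_real_derivative - 1 / (R\<^sup>2 - ?x)\<^sup>2) (at ?x)"
    using x by (auto intro!: derivative_eq_intros simp: power2_eq_square)
  ultimately have "has_laplacian (\<lambda>w. ln (R\<^sup>2 - (norm (w - q))\<^sup>2)) z
      (4 * (?x * (- 1 / (R\<^sup>2 - ?x)\<^sup>2) + - 1 / (R\<^sup>2 - ?x)))"
    by (rule has_laplacian_radial)
  moreover have "4 * (?x * (- 1 / (R\<^sup>2 - ?x)\<^sup>2) + - 1 / (R\<^sup>2 - ?x)) = - 4 * (R / (R\<^sup>2 - ?x))\<^sup>2"
    using x by (simp add: divide_simps power2_eq_square)
  ultimately show ?thesis by simp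
qed

text \<open>The quotient p of \<open>\<mu>\<close> by the Poincare density vanishes on the boundary
  circle, where \<open>\<mu>\<close> is still finite; this is why the closed disk lies in G. Where p
  > 1, the Laplacian of log p is at least 4 (\<mu>^2 - density^2) > 0, so p cannot have a maximum
  above 1.\<close>

lemma ahlfors_bound:
  assumes \<mu>: "conformal_pseudometric G \<mu>" and R: "0 < R" "cball q R \<subseteq> G"
    and curv: "\<And>z. z \<in> ball q R \<Longrightarrow> 0 < \<mu> z \<Longrightarrow> curvature \<mu> z \<le> - 4"
    and z: "z \<in> ball q R"
  shows "\<mu> z \<le> R / (R\<^sup>2 - (norm (z - q))\<^sup>2)"
proof -
  have cont: "continuous_on (cball q R) \<mu>"
    using \<mu> R(2) continuous_on_subset unfolding conformal_pseudometric_def by blast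
  have pos: "0 < R\<^sup>2 - (norm (w - q))\<^sup>2" if "w \<in> ball q R" for w
    using that by (simp add: dist_norm norm_minus_commute power_strict_mono)
  define p where "p w = \<mu> w * ((R\<^sup>2 - (norm (w - q))\<^sup>2) / R)" for w
  have \<mu>_pos: "0 < \<mu> w" if "w \<in> ball q R" "1 < p w" for w
  proof -
    have "0 < \<mu> w * ((R\<^sup>2 - (norm (w - q))\<^sup>2) / R)"
      using that(2) by (simp add: p_def)
    moreover have "0 < (R\<^sup>2 - (norm (w - q))\<^sup>2) / R"
      using pos[OF that(1)] R(1) by simp
    ultimately show ?thesis
      by (rule zero_less_mult_pos2)
  qed
  have contp: "continuous_on (cball q R) p"
    unfolding p_def using R(1) by (intro continuous_intros cont) auto
  have "ln (max (p z) 1) \<le> 0"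
  proof (rule maximum_principle[where K = "cball q R" and W = "ball q R"])
    show "compact (cball q R)" "open (ball q R)" "ball q R \<subseteq> cball q R" "z \<in> cball q R"
      using z by auto
    show "continuous_on (cball q R) (\<lambda>w. ln (max (p w) 1))"
      by (intro continuous_intros contp) auto
    show "ln (max (p w) 1) \<le> 0" if "w \<in> cball q R - ball q R" for w
    proof -
      have "norm (w - q) = R"
        using that by (auto simp: dist_norm norm_minus_commute)
      then show ?thesis by (simp add: p_def)
    qed
  next
    fix w assume w: "w \<in> ball q R" "0 < ln (max (p w) 1)"
    have "1 < p w"
      using w(2) by (auto simp: max_def split: if_splits)
    then have "0 < \<mu> w"
      using w(1) by (intro \<mu>_pos)
    have "w \<in> G" using w(1) R(2) by auto
    let ?L = "(- curvature \<mu> w * (\<mu> w)\<^sup>2 + - 4 * (R / (R\<^sup>2 - (norm (w - q))\<^sup>2))\<^sup>2) - 0"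
    have F: "has_laplacian (\<lambda>w. (ln (\<mu> w) + ln (R\<^sup>2 - (norm (w - q))\<^sup>2)) - ln R) w ?L"
      using w(1) by (intro has_laplacian_diff has_laplacian_add has_laplacian_const
          has_laplacian_ln_diff_norm_sq conformal_pseudometric_has_laplacian_ln[OF \<mu> \<open>w \<in> G\<close> \<open>0 < \<mu> w\<close>])
        (auto simp: dist_norm norm_minus_commute)
    have "has_laplacian (\<lambda>w. ln (max (p w) 1)) w ?L"
    proof (rule has_laplacian_ln_max[where p = p, OF open_ball _ w F])
      show "continuous_on (ball q R) p"
        using contp by (rule continuous_on_subset) auto
      show "ln (\<mu> v) + ln (R\<^sup>2 - (norm (v - q))\<^sup>2) - ln R = ln (p v)"
        if v: "v \<in> ball q R" "1 < p v" for v
      proof -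
        have "0 < \<mu> v"
          using v by (rule \<mu>_pos)
        then show ?thesis
          using pos[OF v(1)] R(1) by (auto simp: p_def ln_mult ln_div)
      qed
    qed
    moreover have "0 < ?L"
    proof -
      have "R / (R\<^sup>2 - (norm (w - q))\<^sup>2) < \<mu> w"
        using \<open>1 < p w\<close> pos[OF w(1)] R(1) by (simp add: p_def field_simps)
      then have "(R / (R\<^sup>2 - (norm (w - q))\<^sup>2))\<^sup>2 < (\<mu> w)\<^sup>2"
        using pos[OF w(1)] R(1) by (intro power_strict_mono divide_nonneg_pos) auto
      moreover have "4 * (\<mu> w)\<^sup>2 \<le> - curvature \<mu> w * (\<mu> w)\<^sup>2"
        using curv[OF w(1) \<open>0 < \<mu> w\<close>] by (intro mult_right_mono) auto
      ultimately show ?thesis by simp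
    qed
    ultimately show "\<exists>L>0. has_laplacian (\<lambda>w. ln (max (p w) 1)) w L" by blast
  qed
  then have "p z \<le> 1"
    by (auto simp: max_def split: if_splits)
  then show ?thesis
    using pos[OF z] R(1) by (simp add: p_def field_simps)
qed

text \<open>The extended quotient enters as any function \<open>h\<close> with its characteristic
  properties, so that the analysis never meets the limit in \<open>quotient_ext\<close>.\<close>

locale comparable_pseudometrics =
  fixes l \<mu> \<kappa> h :: "complex \<Rightarrow> real" and c :: real
  assumes l: "conformal_pseudometric (ball 0 1) l"
    and \<mu>: "conformal_pseudometric (ball 0 1) \<mu>"
    and curvature_\<mu>: "\<And>z. z \<in> ball 0 1 \<Longrightarrow> 0 < \<mu> z \<Longrightarrow> curvature \<mu> z = \<kappa> z"
    and \<kappa>: "\<And>z. z \<in> ball 0 1 \<Longrightarrow> - c \<le> \<kappa> z" "\<And>z. z \<in> ball 0 1 \<Longrightarrow> \<kappa> z \<le> - 4"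
    and curvature_le: "\<And>z. z \<in> ball 0 1 \<Longrightarrow> 0 < l z \<Longrightarrow> 0 < \<mu> z \<Longrightarrow> curvature l z \<le> curvature \<mu> z"
    and discrete_zeros: "discrete {z \<in> ball 0 1. \<mu> z = 0}"
    and cont_h: "continuous_on (ball 0 1) h"
    and h_range: "\<And>z. z \<in> ball 0 1 \<Longrightarrow> 0 \<le> h z" "\<And>z. z \<in> ball 0 1 \<Longrightarrow> h z \<le> 1"
    and h_eq: "\<And>z. z \<in> ball 0 1 \<Longrightarrow> \<mu> z \<noteq> 0 \<Longrightarrow> h z = l z / \<mu> z"
begin

lemma c_ge_4: "4 \<le> c"
  using \<kappa>[of 0] by simp

lemma \<mu>_bound:
  assumes "0 < R" "cball q R \<subseteq> ball 0 1" "z \<in> ball q R"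
  shows "\<mu> z \<le> R / (R\<^sup>2 - (norm (z - q))\<^sup>2)"
proof (rule ahlfors_bound[OF \<mu> assms(1,2) _ assms(3)])
  fix w assume "w \<in> ball q R" "0 < \<mu> w"
  moreover from this have "w \<in> ball 0 1"
    using assms(2) ball_subset_cball by blast
  ultimately show "curvature \<mu> w \<le> - 4"
    using curvature_\<mu> \<kappa>(2) by simp
qed

text \<open>Since $e^{2u} - 1 \ge 2u$, the logarithm $u$ of the quotient satisfies the linear inequality
  $\Delta u \ge 2 c \mu^2 u$, for which the barrier below is a supersolution after multiplication
  by $M \le 0$.\<close>

lemma radial_comparison:
  assumes R: "0 < \<rho>" "\<rho> < R" "cball q R \<subseteq> ball 0 1"
    and M: "M \<le> 0" and sphere: "\<And>w. w \<in> sphere q \<rho> \<Longrightarrow> h w \<le> exp M"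
    and \<phi>: "continuous_on {\<rho>\<^sup>2..R\<^sup>2} \<phi>" "\<phi> (\<rho>\<^sup>2) \<le> 1" "\<phi> (R\<^sup>2) = 0"
      "\<And>x. x \<in> {\<rho>\<^sup>2<..<R\<^sup>2} \<Longrightarrow> 0 \<le> \<phi> x"
    and d1: "\<And>x. x \<in> {\<rho>\<^sup>2<..<R\<^sup>2} \<Longrightarrow> (\<phi> has_real_derivative \<phi>' x) (at x)"
    and d2: "\<And>x. x \<in> {\<rho>\<^sup>2<..<R\<^sup>2} \<Longrightarrow> (\<phi>' has_real_derivative \<phi>'' x) (at x)"
    and super: "\<And>x. x \<in> {\<rho>\<^sup>2<..<R\<^sup>2} \<Longrightarrow> 2 * c * \<phi> x * (R / (R\<^sup>2 - x))\<^sup>2 \<le> 4 * (x * \<phi>'' x + \<phi>' x)"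
    and z: "\<rho> \<le> norm (z - q)" "norm (z - q) \<le> R"
  shows "h z \<le> exp (M * \<phi> ((norm (z - q))\<^sup>2))"
proof -
  define K where "K = cball q R - ball q \<rho>"
  define W where "W = ball q R - cball q \<rho>"
  let ?x = "\<lambda>w. (norm (w - q))\<^sup>2"
  \<comment> \<open>The claim is p \<le> 1. In this multiplicative form zeros of \<open>h\<close>
    are harmless, unlike in log h - M \<phi>.\<close>
  define p where "p w = h w * exp (- M * \<phi> (?x w))" for w
  have K: "w \<in> ball 0 1" "?x w \<in> {\<rho>\<^sup>2..R\<^sup>2}" if "w \<in> K" for w
    using that R by (auto simp: K_def dist_norm norm_minus_commute intro!: power_mono)
  have "W \<subseteq> K"
    by (auto simp: K_def W_def)
  then have W: "w \<in> K" "w \<in> ball 0 1" "w \<in> ball q R" "?x w \<in> {\<rho>\<^sup>2<..<R\<^sup>2}" if "w \<in> W" for w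
    using that R K(1) by (auto simp: W_def dist_norm norm_minus_commute intro!: power_strict_mono)
  have openW: "open W" "W \<subseteq> K"
    using W(1) by (auto simp: W_def)
  have "continuous_on K (\<lambda>w. \<phi> (?x w))"
    by (rule continuous_on_compose2[OF \<phi>(1)]) (use K(2) in \<open>auto intro!: continuous_intros\<close>)
  moreover have "continuous_on K h"
    using cont_h by (rule continuous_on_subset) (use K(1) in auto)
  ultimately have contp: "continuous_on K p"
    unfolding p_def by (intro continuous_intros)
  have "ln (max (p z) 1) \<le> 0"
  proof (rule maximum_principle_isolated[where K = K and W = W and Z = "{w \<in> ball 0 1. \<mu> w = 0}"])
    show "compact K"
      unfolding K_def by (intro compact_diff) auto
    show "open W" "W \<subseteq> K" by (fact openW)+
    show "z \<in> K"
      using z by (auto simp: K_def dist_norm norm_minus_commute)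
    show "continuous_on K (\<lambda>w. ln (max (p w) 1))"
      by (intro continuous_intros contp) auto
  next
    fix w assume w: "w \<in> K - W"
    have "p w \<le> 1"
    proof (cases "norm (w - q) = R")
      case True
      then show ?thesis
        using h_range(2)[of w] K(1)[of w] w \<phi>(3) by (simp add: p_def)
    next
      case False
      with w have \<rho>: "norm (w - q) = \<rho>"
        by (auto simp: K_def W_def dist_norm norm_minus_commute)
      then have "h w \<le> exp M"
        by (intro sphere) (simp add: dist_norm norm_minus_commute)
      moreover have "M * 1 \<le> M * \<phi> (?x w)"
        using M \<phi>(2) \<rho> by (intro mult_left_mono_neg) auto
      ultimately have "h w \<le> exp (M * \<phi> (?x w))"
        by (smt (verit) exp_le_cancel_iff)
      then show ?thesis
        by (simp add: p_def exp_minus field_simps)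
    qed
    then show "ln (max (p w) 1) \<le> 0" by simp
  next
    fix w assume w: "w \<in> W \<inter> {w \<in> ball 0 1. \<mu> w = 0}"
    then have "w isolated_in {w \<in> ball 0 1. \<mu> w = 0}"
      using discrete_zeros by (auto simp: discrete_def)
    then obtain T where T: "open T" "T \<inter> {w \<in> ball 0 1. \<mu> w = 0} = {w}"
      unfolding isolated_in_def by blast
    then obtain e where "0 < e" "ball w e \<subseteq> T"
      using openE[of T w] by blast
    with T(2) show "\<exists>e>0. ball w e \<inter> {w \<in> ball 0 1. \<mu> w = 0} \<subseteq> {w}"
      by blast
  next
    fix w assume w: "w \<in> W - {w \<in> ball 0 1. \<mu> w = 0}" "0 < ln (max (p w) 1)"
    then have wW: "w \<in> W" and "\<mu> w \<noteq> 0"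
      using W(2) by auto
    note wD = W(2)[OF wW] and x = W(4)[OF wW]
    have pos: "0 < \<mu> w"
      using \<open>\<mu> w \<noteq> 0\<close> wD \<mu> by (auto simp: conformal_pseudometric_def less_le)
    have "1 < p w"
      using w(2) by (auto simp: max_def split: if_splits)
    have h_pos: "0 < h v" if "1 < p v" for v
      using less_trans[OF zero_less_one that] by (simp add: p_def zero_less_mult_iff)
    have hw: "0 < h w" "h w = l w / \<mu> w"
      using h_pos[OF \<open>1 < p w\<close>] h_eq[OF wD] pos by auto
    then have l_pos: "0 < l w"
      using pos by (simp add: zero_less_divide_iff)
    let ?D = "4 * (?x w * \<phi>'' (?x w) + \<phi>' (?x w))"
    let ?L = "- curvature l w * (l w)\<^sup>2 - (- curvature \<mu> w * (\<mu> w)\<^sup>2) - M * ?D"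
    have "\<forall>\<^sub>F x in nhds (?x w). x \<in> {\<rho>\<^sup>2<..<R\<^sup>2}"
      using x by (intro eventually_nhds_in_open) auto
    then have "\<forall>\<^sub>F x in nhds (?x w). (\<phi> has_real_derivative \<phi>' x) (at x)"
      by eventually_elim (rule d1)
    then have \<phi>_lap: "has_laplacian (\<lambda>w. \<phi> (?x w)) w ?D"
      using d2[OF x] by (rule has_laplacian_radial)
    have F: "has_laplacian (\<lambda>w. ln (l w) - ln (\<mu> w) - M * \<phi> (?x w)) w ?L"
      using wD pos l_pos \<phi>_lap by (intro has_laplacian_diff has_laplacian_cmult
          conformal_pseudometric_has_laplacian_ln[OF l] conformal_pseudometric_has_laplacian_ln[OF \<mu>])
    \<comment> \<open>The formula for log p through \<open>l\<close> and \<open>\<mu>\<close> holds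
      only off the zeros of \<open>\<mu>\<close>, so the neighbourhood must avoid them.\<close>
    let ?V = "W \<inter> {z \<in> ball 0 1. 0 < \<mu> z}"
    have "has_laplacian (\<lambda>w. ln (max (p w) 1)) w ?L"
    proof (rule has_laplacian_ln_max[where p = p, OF _ _ _ w(2) F])
      show "open ?V"
        using openW(1) conformal_pseudometric_open_pos[OF \<mu>] by blast
      show "continuous_on ?V p"
        using contp by (rule continuous_on_subset) (use openW(2) in auto)
      show "w \<in> ?V"
        using wW wD pos by auto
      show "ln (l v) - ln (\<mu> v) - M * \<phi> (?x v) = ln (p v)" if v: "v \<in> ?V" "1 < p v" for v
      proof -
        have "0 < h v" "h v = l v / \<mu> v"
          using h_pos[OF v(2)] h_eq[of v] v(1) by auto
        moreover from this have "0 < l v"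
          using v(1) by (simp add: zero_less_divide_iff)
        ultimately show ?thesis
          using v(1) by (simp add: p_def ln_mult ln_div)
      qed
    qed
    moreover have "0 < ?L"
    proof -
      define k where "k = - \<kappa> w"
      define u where "u = ln (h w)"
      have k: "4 \<le> k" "k \<le> c"
        using \<kappa>[OF wD] by (auto simp: k_def)
      have u: "u \<le> 0" "0 < u - M * \<phi> (?x w)"
      proof -
        show "u \<le> 0"
          using hw(1) h_range(2)[OF wD] by (simp add: u_def)
        have "0 < ln (p w)"
          using \<open>1 < p w\<close> by simp
        then show "0 < u - M * \<phi> (?x w)"
          using hw(1) by (simp add: p_def u_def ln_mult)
      qed
      have "1 + 2 * u \<le> exp (2 * u)"
        by simp
      also have "exp (2 * u) = (h w)\<^sup>2"
        using hw(1) by (simp add: u_def exp_double)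
      finally have "2 * u * (\<mu> w)\<^sup>2 \<le> ((h w)\<^sup>2 - 1) * (\<mu> w)\<^sup>2"
        by (intro mult_right_mono) auto
      also have "\<dots> = (l w)\<^sup>2 - (\<mu> w)\<^sup>2"
        using hw(2) pos by (simp add: power_divide left_diff_distrib)
      finally have "k * (2 * u * (\<mu> w)\<^sup>2) \<le> k * ((l w)\<^sup>2 - (\<mu> w)\<^sup>2)"
        using k(1) by (intro mult_left_mono) auto
      \<comment> \<open>As u \<le> 0, replacing k by the larger c lowers the left side: the
        curvature bound -c \<le> \<kappa> enters here.\<close>
      moreover have "c * (2 * u * (\<mu> w)\<^sup>2) \<le> k * (2 * u * (\<mu> w)\<^sup>2)"
        using k(2) u(1) by (intro mult_right_mono_neg) (auto simp: mult_nonpos_nonneg)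
      moreover have "k * (l w)\<^sup>2 \<le> - curvature l w * (l w)\<^sup>2"
        using curvature_le[OF wD l_pos pos] curvature_\<mu>[OF wD pos]
        by (intro mult_right_mono) (auto simp: k_def)
      moreover have "curvature \<mu> w = - k"
        using curvature_\<mu>[OF wD pos] by (simp add: k_def)
      \<comment> \<open>Ahlfors' bound exchanges \<open>\<mu>\<close> for the Poincare density of
        \<open>super\<close>; the direction is right because \<open>\<phi>\<close> is nonnegative
        and M \<le> 0.\<close>
      moreover have "- M * (2 * c * \<phi> (?x w) * (\<mu> w)\<^sup>2) \<le> - M * ?D"
      proof (rule mult_left_mono)
        have "(\<mu> w)\<^sup>2 \<le> (R / (R\<^sup>2 - ?x w))\<^sup>2"
          using \<mu>_bound[OF _ R(3) W(3)[OF wW]] R pos by (intro power_mono) auto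
        then have "2 * c * \<phi> (?x w) * (\<mu> w)\<^sup>2 \<le> 2 * c * \<phi> (?x w) * (R / (R\<^sup>2 - ?x w))\<^sup>2"
          using c_ge_4 \<phi>(4)[OF x] by (intro mult_left_mono) auto
        then show "2 * c * \<phi> (?x w) * (\<mu> w)\<^sup>2 \<le> ?D"
          using super[OF x] by simp
      qed (use M in simp)
      \<comment> \<open>Together the estimates bound the Laplacian below by this number, in which u
        - M \<phi> is just log p.\<close>
      moreover have "0 < 2 * c * (\<mu> w)\<^sup>2 * (u - M * \<phi> (?x w))"
        using c_ge_4 pos u(2) by simp
      ultimately show ?thesis
        by (simp add: algebra_simps)
    qed
    ultimately show "\<exists>L>0. has_laplacian (\<lambda>w. ln (max (p w) 1)) w L" by blast
  qed
  then have "p z \<le> 1"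
    by (auto simp: max_def split: if_splits)
  then show ?thesis
    by (simp add: p_def exp_minus field_simps)
qed

end

section \<open>Barriers\<close>

text \<open>With s = exp t this is t \<le> sinh t; the difference of the two sides vanishes at 1 and
  has derivative (1 - 1/s)^2.\<close>

lemma two_ln_le_diff_inverse:
  fixes s :: real
  assumes "1 \<le> s"
  shows "2 * ln s \<le> s - 1 / s"
proof -
  define g where "g s = s - 1 / s - 2 * ln s" for s :: real
  have "g 1 \<le> g s"
  proof (rule DERIV_nonneg_imp_nondecreasing[OF assms])
    fix x :: real assume x: "1 \<le> x" "x \<le> s"
    have "(g has_real_derivative (1 + 1 / (x * x)) - 2 * (1 / x)) (at x)"
      unfolding g_def using x by (auto intro!: derivative_eq_intros)
    moreover have "(1 + 1 / (x * x)) - 2 * (1 / x) = (1 - 1 / x)\<^sup>2"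
      by (simp add: power2_eq_square algebra_simps)
    ultimately show "\<exists>y. (g has_real_derivative y) (at x) \<and> 0 \<le> y"
      by (metis zero_le_power2)
  qed
  then show ?thesis by (simp add: g_def)
qed

lemma ln_square_ratio_pos:
  fixes a b :: real
  assumes "0 < a" "a < b"
  shows "0 < ln (b\<^sup>2 / a\<^sup>2)"
proof (rule ln_gt_zero)
  have "a\<^sup>2 < b\<^sup>2"
    using assms by (intro power_strict_mono) auto
  then show "1 < b\<^sup>2 / a\<^sup>2"
    using assms by simp
qed

text \<open>With |z|^2 = x, this says that R/(R^2 - |z|^2) \<le> 1/(|z| log(R^2/|z|^2)): the
  Poincare density of the disk of radius R is at most that of the punctured disk, both of curvature
  -4. It follows from the previous inequality at s = R/|z|.\<close>

lemma ln_ratio_bound: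
  fixes x R :: real
  assumes "0 < x" "x < R\<^sup>2" "0 < R"
  shows "(ln (R\<^sup>2 / x))\<^sup>2 * x * R\<^sup>2 \<le> (R\<^sup>2 - x)\<^sup>2"
proof -
  define s where "s = R / sqrt x"
  have sx: "sqrt x < R"
    using assms real_less_lsqrt by simp
  have s: "1 \<le> s"
    using sx assms(1) by (simp add: s_def)
  have s2: "s\<^sup>2 = R\<^sup>2 / x"
    using assms(1) by (simp add: s_def power_divide)
  have "ln (R\<^sup>2 / x) = 2 * ln s"
    using s by (simp flip: s2 add: ln_realpow)
  also have "\<dots> \<le> s - 1 / s"
    using s by (rule two_ln_le_diff_inverse)
  also have "\<dots> = (R\<^sup>2 - x) / (R * sqrt x)"
  proof -
    have "sqrt x * sqrt x = x" using assms(1) by simp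
    then show ?thesis
      using assms by (simp add: s_def field_simps power2_eq_square)
  qed
  finally have "ln (R\<^sup>2 / x) * (R * sqrt x) \<le> R\<^sup>2 - x"
    using assms by (simp add: field_simps)
  moreover have "0 \<le> ln (R\<^sup>2 / x)"
    using assms by simp
  ultimately have "(ln (R\<^sup>2 / x) * (R * sqrt x))\<^sup>2 \<le> (R\<^sup>2 - x)\<^sup>2"
    using assms by (intro power_mono) auto
  then show ?thesis
    using assms(1) by (simp add: power_mult_distrib mult_ac)
qed

context comparable_pseudometrics
begin

text \<open>The function \<open>ln (R\<^sup>2 / (norm (w - q))\<^sup>2)\<close> is harmonic, and by \<open>ln_ratio_bound\<close> its
  powers with exponent at least 2 are admissible barriers.\<close>

lemma log_comparison:
  assumes R: "0 < \<rho>" "\<rho> < R" "cball q R \<subseteq> ball 0 1"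
    and M: "M \<le> 0" and sphere: "\<And>w. w \<in> sphere q \<rho> \<Longrightarrow> h w \<le> exp M"
    and z: "\<rho> \<le> norm (z - q)" "norm (z - q) \<le> R"
  shows "h z \<le> exp (M * (ln (R\<^sup>2 / (norm (z - q))\<^sup>2) / ln (R\<^sup>2 / \<rho>\<^sup>2)) powr (c / 2))"
proof -
  define a where "a = c / 2"
  have a: "2 \<le> a" "c = 2 * a" using c_ge_4 by (auto simp: a_def)
  define D where "D = ln (R\<^sup>2 / \<rho>\<^sup>2)"
  have D: "0 < D"
    unfolding D_def using R(1,2) by (rule ln_square_ratio_pos)
  have \<rho>R: "0 < \<rho>\<^sup>2" "\<rho>\<^sup>2 < R\<^sup>2"
    using R by (auto intro: power_strict_mono)
  define k where "k = 1 / D powr a"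
  have k: "0 < k" using D by (simp add: k_def)
  define \<sigma> where "\<sigma> x = ln (R\<^sup>2 / x)" for x
  have \<sigma>: "0 < \<sigma> x" "0 < x" if "x \<in> {\<rho>\<^sup>2<..<R\<^sup>2}" for x
  proof -
    show "0 < x" using less_trans[OF \<rho>R(1)] that by simp
    then show "0 < \<sigma> x" using that by (auto simp: \<sigma>_def intro!: ln_gt_zero)
  qed
  have d\<sigma>: "(\<sigma> has_real_derivative - 1 / x) (at x)" if "0 < x" for x
    unfolding \<sigma>_def using that R(1,2)
    by (auto intro!: derivative_eq_intros simp: field_simps power2_eq_square)
  define \<phi> where "\<phi> x = k * \<sigma> x powr a" for x
  define \<phi>' where "\<phi>' x = - k * a * \<sigma> x powr (a - 1) / x" for x
  define \<phi>'' where "\<phi>'' x = k * a * (a - 1) * \<sigma> x powr (a - 2) / x\<^sup>2 + k * a * \<sigma> x powr (a - 1) / x\<^sup>2" for x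
  have "h z \<le> exp (M * \<phi> ((norm (z - q))\<^sup>2))"
  proof (rule radial_comparison[OF R M sphere, where \<phi> = \<phi> and \<phi>' = \<phi>' and \<phi>'' = \<phi>''])
    have "0 \<le> \<sigma> x \<and> x \<noteq> 0" if "x \<in> {\<rho>\<^sup>2..R\<^sup>2}" for x
    proof -
      have "0 < x" using less_le_trans[OF \<rho>R(1)] that by simp
      then show ?thesis using that by (simp add: \<sigma>_def)
    qed
    moreover have "continuous_on {\<rho>\<^sup>2..R\<^sup>2} \<sigma>"
      unfolding \<sigma>_def using \<rho>R by (intro continuous_intros) auto
    ultimately show "continuous_on {\<rho>\<^sup>2..R\<^sup>2} \<phi>"
      unfolding \<phi>_def using a(1) by (intro continuous_intros continuous_on_powr') auto
    show "\<phi> (\<rho>\<^sup>2) \<le> 1"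
      using D by (simp add: \<phi>_def k_def \<sigma>_def flip: D_def)
    show "\<phi> (R\<^sup>2) = 0"
      using R by (simp add: \<phi>_def \<sigma>_def)
    show "\<rho> \<le> norm (z - q)" "norm (z - q) \<le> R" by (fact z)+
  next
    fix x assume x: "x \<in> {\<rho>\<^sup>2<..<R\<^sup>2}"
    note \<sigma>x = \<sigma>[OF x]
    show "0 \<le> \<phi> x" using k by (simp add: \<phi>_def)
    have dpowr: "((\<lambda>x. \<sigma> x powr b) has_real_derivative b * \<sigma> x powr (b - 1) * (- 1 / x)) (at x)" for b
      using DERIV_fun_powr[OF d\<sigma>[OF \<sigma>x(2)] \<sigma>x(1), of b] by simp
    show "(\<phi> has_real_derivative \<phi>' x) (at x)"
      unfolding \<phi>_def \<phi>'_def using DERIV_cmult[OF dpowr[of a], of k] by (simp add: mult_ac)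
    have "((\<lambda>x. \<sigma> x powr (a - 1) / x) has_real_derivative
       (((a - 1) * \<sigma> x powr (a - 1 - 1) * (- 1 / x)) * x - \<sigma> x powr (a - 1) * 1) / (x * x)) (at x)"
      using \<sigma>x(2) by (intro DERIV_divide dpowr DERIV_ident) auto
    from DERIV_cmult[OF this, of "- k * a"]
    show "(\<phi>' has_real_derivative \<phi>'' x) (at x)"
      unfolding \<phi>'_def \<phi>''_def using \<sigma>x(2)
      by (auto simp: field_simps power2_eq_square elim!: DERIV_cong)
    \<comment> \<open>Harmonicity of \<open>\<sigma>\<close> cancels the terms with exponent a - 1;
      only the squared gradient contributes.\<close>
    have "x * \<phi>'' x + \<phi>' x = k * a * (a - 1) * \<sigma> x powr (a - 2) / x"
      using \<sigma>x(2) by (simp add: \<phi>'_def \<phi>''_def field_simps power2_eq_square)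
    moreover have "\<sigma> x powr a = \<sigma> x powr (a - 2) * (\<sigma> x)\<^sup>2"
      using \<sigma>x(1) by (simp add: powr_diff)
    moreover have "(\<sigma> x)\<^sup>2 * (R / (R\<^sup>2 - x))\<^sup>2 \<le> (a - 1) / x"
    proof -
      have "(\<sigma> x)\<^sup>2 * x * R\<^sup>2 \<le> (R\<^sup>2 - x)\<^sup>2"
        unfolding \<sigma>_def using \<sigma>x(2) x R by (intro ln_ratio_bound) auto
      then have "(\<sigma> x)\<^sup>2 * (R / (R\<^sup>2 - x))\<^sup>2 \<le> 1 / x"
        using \<sigma>x(2) x by (simp add: power_divide divide_simps mult_ac)
      \<comment> \<open>The condition 4 \<le> c enters the barrier inequality as 1 \<le> a -
        1.\<close>
      also have "\<dots> \<le> (a - 1) / x"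
        using a(1) \<sigma>x(2) by (intro divide_right_mono) auto
      finally show ?thesis .
    qed
    then have "4 * k * a * \<sigma> x powr (a - 2) * ((\<sigma> x)\<^sup>2 * (R / (R\<^sup>2 - x))\<^sup>2) \<le>
        4 * k * a * \<sigma> x powr (a - 2) * ((a - 1) / x)"
      using k a(1) by (intro mult_left_mono) auto
    ultimately show "2 * c * \<phi> x * (R / (R\<^sup>2 - x))\<^sup>2 \<le> 4 * (x * \<phi>'' x + \<phi>' x)"
      by (simp add: \<phi>_def a(2) mult_ac)
  qed
  moreover have "\<phi> ((norm (z - q))\<^sup>2) = (ln (R\<^sup>2 / (norm (z - q))\<^sup>2) / ln (R\<^sup>2 / \<rho>\<^sup>2)) powr (c / 2)"
  proof -
    have "0 < norm (z - q)" using z(1) R(1) by linarith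
    moreover have "(norm (z - q))\<^sup>2 \<le> R\<^sup>2"
      using z by (intro power_mono) auto
    ultimately have "0 \<le> ln (R\<^sup>2 / (norm (z - q))\<^sup>2)"
      by simp
    then show ?thesis
      using D by (simp add: \<phi>_def k_def \<sigma>_def powr_divide flip: D_def a_def)
  qed
  ultimately show ?thesis by simp
qed

text \<open>For (R^2 - x)^a the differential inequality reduces to (a - 1) x - (R^2 - x) \<ge> R^2,
  that is a x \<ge> 2 R^2. The worst point of the annulus is x = \<rho>^2, which gives the condition
  \<open>large\<close>.\<close>

lemma powr_comparison:
  assumes R: "0 < \<rho>" "\<rho> < R" "cball q R \<subseteq> ball 0 1"
    and large: "4 * R\<^sup>2 \<le> c * \<rho>\<^sup>2"
    and M: "M \<le> 0" and sphere: "\<And>w. w \<in> sphere q \<rho> \<Longrightarrow> h w \<le> exp M"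
    and z: "\<rho> \<le> norm (z - q)" "norm (z - q) \<le> R"
  shows "h z \<le> exp (M * ((R\<^sup>2 - (norm (z - q))\<^sup>2) / (R\<^sup>2 - \<rho>\<^sup>2)) powr (c / 2))"
proof -
  define a where "a = c / 2"
  have a: "2 \<le> a" "c = 2 * a" using c_ge_4 by (auto simp: a_def)
  define D where "D = R\<^sup>2 - \<rho>\<^sup>2"
  have D: "0 < D"
    using R by (simp add: D_def power_strict_mono)
  define k where "k = 1 / D powr a"
  have k: "0 < k" using D by (simp add: k_def)
  define \<phi> where "\<phi> x = k * (R\<^sup>2 - x) powr a" for x
  define \<phi>' where "\<phi>' x = - k * a * (R\<^sup>2 - x) powr (a - 1)" for x
  define \<phi>'' where "\<phi>'' x = k * a * (a - 1) * (R\<^sup>2 - x) powr (a - 2)" for x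
  have "h z \<le> exp (M * \<phi> ((norm (z - q))\<^sup>2))"
  proof (rule radial_comparison[OF R M sphere, where \<phi> = \<phi> and \<phi>' = \<phi>' and \<phi>'' = \<phi>''])
    show "continuous_on {\<rho>\<^sup>2..R\<^sup>2} \<phi>"
      unfolding \<phi>_def using a(1) by (intro continuous_intros continuous_on_powr') auto
    show "\<phi> (\<rho>\<^sup>2) \<le> 1"
      using D by (simp add: \<phi>_def k_def flip: D_def)
    show "\<phi> (R\<^sup>2) = 0"
      by (simp add: \<phi>_def)
    show "\<rho> \<le> norm (z - q)" "norm (z - q) \<le> R" by (fact z)+
  next
    fix x assume x: "x \<in> {\<rho>\<^sup>2<..<R\<^sup>2}"
    let ?y = "R\<^sup>2 - x"
    have y: "0 < ?y" using x by simp
    show "0 \<le> \<phi> x" using k by (simp add: \<phi>_def)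
    have "((\<lambda>x. R\<^sup>2 - x) has_real_derivative - 1) (at x)"
      by (auto intro!: derivative_eq_intros)
    then have dpowr: "((\<lambda>x. (R\<^sup>2 - x) powr b) has_real_derivative b * ?y powr (b - 1) * (- 1)) (at x)" for b
      using DERIV_fun_powr[of "\<lambda>x. R\<^sup>2 - x" "- 1" x b] y by simp
    show "(\<phi> has_real_derivative \<phi>' x) (at x)"
      unfolding \<phi>_def \<phi>'_def using DERIV_cmult[OF dpowr[of a], of k] by (simp add: mult_ac)
    show "(\<phi>' has_real_derivative \<phi>'' x) (at x)"
      unfolding \<phi>'_def \<phi>''_def
      using DERIV_cmult[OF dpowr[of "a - 1"], of "- k * a"] by (simp add: mult_ac)
    have y1: "?y powr (a - 1) = ?y powr (a - 2) * ?y"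
      using y powr_add[of ?y "a - 2" 1] by simp
    have y2: "?y powr a = ?y powr (a - 2) * ?y\<^sup>2"
      using y by (simp add: powr_diff)
    have "2 * R\<^sup>2 \<le> a * \<rho>\<^sup>2"
      using large a(2) by simp
    also have "\<dots> \<le> a * x"
      using x a(1) by (intro mult_left_mono) auto
    finally have "4 * k * a * ?y powr (a - 2) * R\<^sup>2 \<le> 4 * k * a * ?y powr (a - 2) * ((a - 1) * x - ?y)"
      using k a(1) by (intro mult_left_mono) (auto simp: algebra_simps)
    moreover have "2 * c * \<phi> x * (R / ?y)\<^sup>2 = 4 * k * a * ?y powr (a - 2) * R\<^sup>2"
      using y by (simp add: \<phi>_def y2 a(2) power_divide)
    moreover have "4 * (x * \<phi>'' x + \<phi>' x) = 4 * k * a * ?y powr (a - 2) * ((a - 1) * x - ?y)"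
      unfolding \<phi>''_def \<phi>'_def y1 by (simp add: algebra_simps)
    ultimately show "2 * c * \<phi> x * (R / ?y)\<^sup>2 \<le> 4 * (x * \<phi>'' x + \<phi>' x)"
      by argo
  qed
  moreover have "\<phi> ((norm (z - q))\<^sup>2) = ((R\<^sup>2 - (norm (z - q))\<^sup>2) / (R\<^sup>2 - \<rho>\<^sup>2)) powr (c / 2)"
  proof -
    have "(norm (z - q))\<^sup>2 \<le> R\<^sup>2"
      using z by (intro power_mono) auto
    then show ?thesis
      using D by (simp add: \<phi>_def k_def powr_divide flip: D_def a_def)
  qed
  ultimately show ?thesis by simp
qed

end

section \<open>Decay of the quotient\<close>

text \<open>The base is the price, per unit of exponent, of passing from the logarithmic to the
  power barrier, and 2/r^2 bounds the exponent c/2 when c r^2 < 4. As the base is at most 1, the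
  largest exponent gives a constant valid for all of them.\<close>

definition decay_const :: "real \<Rightarrow> real" where
  "decay_const r = ((1 - r\<^sup>2) / ln (1 / r\<^sup>2)) powr (2 / r\<^sup>2)"

lemma one_minus_le_ln_inverse:
  fixes x :: real
  assumes "0 < x"
  shows "1 - x \<le> ln (1 / x)"
  using ln_le_minus_one[OF assms] assms by (simp add: ln_div)

lemma decay_const_bounds:
  assumes "0 < r" "r < 1"
  shows "0 < (1 - r\<^sup>2) / ln (1 / r\<^sup>2)" "(1 - r\<^sup>2) / ln (1 / r\<^sup>2) \<le> 1"
    and "0 < decay_const r" "decay_const r \<le> 1"
proof -
  have "0 < 1 - r\<^sup>2"
    using assms by (simp add: power_less_one_iff)
  moreover have "1 - r\<^sup>2 \<le> ln (1 / r\<^sup>2)"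
    using assms by (intro one_minus_le_ln_inverse) auto
  ultimately show *: "0 < (1 - r\<^sup>2) / ln (1 / r\<^sup>2)" "(1 - r\<^sup>2) / ln (1 / r\<^sup>2) \<le> 1"
    by (auto intro: divide_pos_pos simp: divide_le_eq_1)
  show "0 < decay_const r"
    unfolding decay_const_def using *(1) by (simp only: powr_gt_zero)
  show "decay_const r \<le> 1"
    unfolding decay_const_def using * by (intro powr_le1) auto
qed

context comparable_pseudometrics
begin

text \<open>The comparison needs a closed disk inside the unit disk, hence R < 1. Since
  \<open>M\<close> is fixed on the circle of radius r, independently of R, the bound at a fixed z
  survives the limit R \<rightarrow> 1.\<close>

lemma log_comparison_unit_disk:
  assumes r: "0 < r" "r < 1" and M: "M \<le> 0"
    and sphere: "\<And>w. w \<in> sphere 0 r \<Longrightarrow> h w \<le> exp M"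
    and z: "r \<le> norm z" "norm z < 1"
  shows "h z \<le> exp (M * (ln (1 / (norm z)\<^sup>2) / ln (1 / r\<^sup>2)) powr (c / 2))"
proof -
  have "0 < norm z" using r z by linarith
  moreover have "0 < ln (1 / (norm z)\<^sup>2)" "0 < ln (1 / r\<^sup>2)"
    using ln_square_ratio_pos[of _ 1] r z \<open>0 < norm z\<close> by auto
  ultimately have "((\<lambda>R. exp (M * (ln (R\<^sup>2 / (norm z)\<^sup>2) / ln (R\<^sup>2 / r\<^sup>2)) powr (c / 2))) \<longlongrightarrow>
      exp (M * (ln (1\<^sup>2 / (norm z)\<^sup>2) / ln (1\<^sup>2 / r\<^sup>2)) powr (c / 2))) (at_left 1)"
    using r by (intro tendsto_intros) auto
  moreover have "\<forall>\<^sub>F R in at_left 1. R \<in> {norm z<..<1}"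
    using z(2) by (rule eventually_at_left_real)
  then have "\<forall>\<^sub>F R in at_left 1. h z \<le> exp (M * (ln (R\<^sup>2 / (norm z)\<^sup>2) / ln (R\<^sup>2 / r\<^sup>2)) powr (c / 2))"
  proof eventually_elim
    case (elim R)
    have "cball 0 R \<subseteq> (ball 0 1 :: complex set)"
      using elim by auto
    then show ?case
      using log_comparison[of r R 0 M z] r M sphere z elim by simp
  qed
  ultimately have "h z \<le> exp (M * (ln (1\<^sup>2 / (norm z)\<^sup>2) / ln (1\<^sup>2 / r\<^sup>2)) powr (c / 2))"
    by (rule tendsto_lowerbound) simp
  then show ?thesis by simp
qed

lemma powr_comparison_unit_disk:
  assumes r: "0 < r" "r < 1" and large: "4 \<le> c * r\<^sup>2" and M: "M \<le> 0"
    and sphere: "\<And>w. w \<in> sphere 0 r \<Longrightarrow> h w \<le> exp M"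
    and z: "r \<le> norm z" "norm z < 1"
  shows "h z \<le> exp (M * ((1 - (norm z)\<^sup>2) / (1 - r\<^sup>2)) powr (c / 2))"
proof -
  have "0 < 1 - (norm z)\<^sup>2" "0 < 1 - r\<^sup>2"
    using r z by (auto simp: power_less_one_iff)
  then have "((\<lambda>R. exp (M * ((R\<^sup>2 - (norm z)\<^sup>2) / (R\<^sup>2 - r\<^sup>2)) powr (c / 2))) \<longlongrightarrow>
      exp (M * ((1\<^sup>2 - (norm z)\<^sup>2) / (1\<^sup>2 - r\<^sup>2)) powr (c / 2))) (at_left 1)"
    by (intro tendsto_intros) auto
  moreover have "\<forall>\<^sub>F R in at_left 1. R \<in> {norm z<..<1}"
    using z(2) by (rule eventually_at_left_real)
  then have "\<forall>\<^sub>F R in at_left 1. h z \<le> exp (M * ((R\<^sup>2 - (norm z)\<^sup>2) / (R\<^sup>2 - r\<^sup>2)) powr (c / 2))"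
  proof eventually_elim
    case (elim R)
    have "cball 0 R \<subseteq> (ball 0 1 :: complex set)"
      using elim by auto
    \<comment> \<open>This makes the single condition 4 \<le> c r^2 sufficient for every R <
      1.\<close>
    moreover have "R\<^sup>2 \<le> 1"
      using elim r z by (intro power_le_one) auto
    ultimately show ?case
      using powr_comparison[of r R 0 M z] r M sphere z elim large by simp
  qed
  ultimately have "h z \<le> exp (M * ((1\<^sup>2 - (norm z)\<^sup>2) / (1\<^sup>2 - r\<^sup>2)) powr (c / 2))"
    by (rule tendsto_lowerbound) simp
  then show ?thesis by simp
qed

text \<open>The power barrier is only admissible for $c r^2 \ge 4$; for the remaining bounded range of
  \<open>c\<close> the logarithmic barrier is comparable to it.\<close>

lemma decay:
  assumes r: "0 < r" "r < 1" and M: "M \<le> 0"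
    and sphere: "\<And>w. w \<in> sphere 0 r \<Longrightarrow> h w \<le> exp M"
    and z: "r \<le> norm z" "norm z < 1"
  shows "h z \<le> exp (M * (decay_const r * ((1 - (norm z)\<^sup>2) / (1 - r\<^sup>2)) powr (c / 2)))"
proof -
  let ?s = "1 - (norm z)\<^sup>2" and ?t = "1 - r\<^sup>2" and ?L = "ln (1 / r\<^sup>2)"
  note C = decay_const_bounds[OF r]
  have s: "0 < ?s" "0 < ?t"
    using r z by (auto simp: power_less_one_iff)
  \<comment> \<open>Because M \<le> 0, a larger factor k gives a stronger bound, so each barrier may
    deliver more than is claimed.\<close>
  have "\<exists>k. decay_const r * (?s / ?t) powr (c / 2) \<le> k \<and> h z \<le> exp (M * k)"
  proof (cases "4 \<le> c * r\<^sup>2")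
    case True
    moreover have "decay_const r * (?s / ?t) powr (c / 2) \<le> 1 * (?s / ?t) powr (c / 2)"
      using C(4) by (intro mult_right_mono) auto
    ultimately show ?thesis
      using powr_comparison_unit_disk[OF r _ M sphere z] by auto
  next
    case False
    then have "c / 2 \<le> 2 / r\<^sup>2"
      using r by (simp add: field_simps)
    then have "decay_const r \<le> (?t / ?L) powr (c / 2)"
      unfolding decay_const_def using C(1,2) by (intro powr_mono') auto
    then have "decay_const r * (?s / ?t) powr (c / 2) \<le> (?t / ?L) powr (c / 2) * (?s / ?t) powr (c / 2)"
      by (intro mult_right_mono) auto
    also have "\<dots> = (?t / ?L * (?s / ?t)) powr (c / 2)"
      using C(1) s by (subst powr_mult) auto
    also have "?t / ?L * (?s / ?t) = ?s / ?L"
      using s by simp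
    also have "(?s / ?L) powr (c / 2) \<le> (ln (1 / (norm z)\<^sup>2) / ?L) powr (c / 2)"
    proof (rule powr_mono2)
      have "0 < ?L"
        using C(1) s(2) by (simp add: zero_less_divide_iff)
      moreover have "?s \<le> ln (1 / (norm z)\<^sup>2)"
        using r z by (intro one_minus_le_ln_inverse) auto
      ultimately show "?s / ?L \<le> ln (1 / (norm z)\<^sup>2) / ?L" "0 \<le> ?s / ?L"
        using s by (auto intro: divide_right_mono)
    qed (use c_ge_4 in simp)
    finally show ?thesis
      using log_comparison_unit_disk[OF r M sphere z] by blast
  qed
  then obtain k where k: "decay_const r * (?s / ?t) powr (c / 2) \<le> k" "h z \<le> exp (M * k)"
    by blast
  note k(2)
  also have "exp (M * k) \<le> exp (M * (decay_const r * (?s / ?t) powr (c / 2)))"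
    using mult_left_mono_neg[OF k(1) M] by simp
  finally show ?thesis .
qed

section \<open>Propagation of the strict inequality through the disk\<close>

lemma sphere_bound:
  assumes "0 < \<rho>" "sphere q \<rho> \<subseteq> ball 0 1" "\<And>w. w \<in> sphere q \<rho> \<Longrightarrow> h w < 1"
  obtains M where "M < 0" "\<And>w. w \<in> sphere q \<rho> \<Longrightarrow> h w \<le> exp M"
proof -
  have "sphere q \<rho> \<noteq> {}" "continuous_on (sphere q \<rho>) h"
    using assms(1) continuous_on_subset[OF cont_h assms(2)] by auto
  then obtain s where s: "s \<in> sphere q \<rho>" "\<And>w. w \<in> sphere q \<rho> \<Longrightarrow> h w \<le> h s"
    using continuous_attains_sup[of "sphere q \<rho>" h] by auto
  \<comment> \<open>The cut at 1/2 keeps the logarithm finite when \<open>h\<close> vanishes on the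
    whole circle.\<close>
  let ?m = "max (h s) (1 / 2)"
  have "0 < ?m" "?m < 1"
    using assms(3)[OF s(1)] by auto
  then have "ln ?m < 0" "exp (ln ?m) = ?m"
    by auto
  then show ?thesis
    using s(2) by (intro that[of "ln ?m"]) (auto simp: le_max_iff_disj)
qed

text \<open>If h q < 1, then \<open>h\<close> stays below 1 on a small circle about q, and the
  logarithmic barrier centred at q is positive at p, forcing h p < 1. The barrier is centred at q,
  not at p, so that the known strict inequality sits on the inner circle.\<close>

lemma eq_1_near_eq_1:
  assumes p: "p \<in> ball 0 1" "h p = 1" and q: "q \<in> ball p ((1 - norm p) / 4)"
  shows "h q = 1"
proof (rule ccontr)
  assume "h q \<noteq> 1"
  \<comment> \<open>As norm p = 1 - 4 d and |p - q| < d, the disk of radius 2 d about q contains p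
    in its interior and stays within norm 1 - d.\<close>
  define d where "d = (1 - norm p) / 4"
  have d: "0 < d" "norm p = 1 - 4 * d"
    using p(1) by (auto simp: d_def field_simps)
  have pq: "norm (p - q) < d"
    using q by (simp add: d_def dist_norm)
  have disk: "w \<in> ball 0 1" if "w \<in> cball q (2 * d)" for w
  proof -
    have "norm (w - q) \<le> 2 * d"
      using that by (simp add: dist_norm norm_minus_commute)
    moreover have "norm w \<le> norm p + norm (p - q) + norm (w - q)"
      using norm_triangle_ineq4[of p "p - q"] norm_triangle_ineq[of q "w - q"] by simp
    ultimately show ?thesis
      using d pq by simp
  qed
  have qD: "q \<in> ball 0 1"
    using disk[of q] d(1) by simp
  then have "h q < 1"
    using h_range(2)[of q] \<open>h q \<noteq> 1\<close> by simp
  have "open (ball 0 1 \<inter> h -` {..<1})"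
    using cont_h by (intro continuous_open_preimage) auto
  then obtain e where e: "0 < e" "ball q e \<subseteq> ball 0 1 \<inter> h -` {..<1}"
    using qD \<open>h q < 1\<close> openE[of _ q] by (metis IntI lessThan_iff vimageI)
  have "q \<noteq> p"
    using p(2) \<open>h q \<noteq> 1\<close> by auto
  define \<rho> where "\<rho> = min e (norm (p - q)) / 2"
  have \<rho>: "0 < \<rho>" "\<rho> < e" "\<rho> < norm (p - q)"
    using e(1) \<open>q \<noteq> p\<close> by (auto simp: \<rho>_def min_def)
  have "sphere q \<rho> \<subseteq> ball q e"
    using \<rho>(2) by auto
  then obtain M where M: "M < 0" "\<And>w. w \<in> sphere q \<rho> \<Longrightarrow> h w \<le> exp M"
    using sphere_bound[of \<rho> q] \<rho>(1) e(2) by blast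
  let ?R = "2 * d"
  have "h p \<le> exp (M * (ln (?R\<^sup>2 / (norm (p - q))\<^sup>2) / ln (?R\<^sup>2 / \<rho>\<^sup>2)) powr (c / 2))"
    using \<rho> pq d(1) M by (intro log_comparison) (auto intro: disk)
  moreover have "0 < ln (?R\<^sup>2 / (norm (p - q))\<^sup>2)" "0 < ln (?R\<^sup>2 / \<rho>\<^sup>2)"
    using \<rho> pq d(1) by (intro ln_square_ratio_pos; linarith)+
  then have "exp (M * (ln (?R\<^sup>2 / (norm (p - q))\<^sup>2) / ln (?R\<^sup>2 / \<rho>\<^sup>2)) powr (c / 2)) < 1"
    using M(1) by (simp add: mult_neg_pos)
  ultimately show False
    using p(2) by simp
qed

lemma strong_maximum_principle:
  assumes "z0 \<in> ball 0 1" "h z0 < 1" "z \<in> ball 0 1"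
  shows "h z < 1"
proof -
  let ?U = "ball 0 1 \<inter> h -` {..<1}" and ?V = "{w \<in> ball 0 1. h w = 1}"
  have "open ?U"
    using cont_h by (intro continuous_open_preimage) auto
  moreover have "open ?V"
    unfolding open_contains_ball
  proof
    fix p assume p: "p \<in> ?V"
    have "ball p ((1 - norm p) / 4) \<subseteq> ?V"
    proof
      fix q assume q: "q \<in> ball p ((1 - norm p) / 4)"
      have "norm q \<le> norm p + norm (q - p)"
        using norm_triangle_ineq[of p "q - p"] by simp
      moreover have "norm (q - p) < (1 - norm p) / 4"
        using q by (simp add: dist_norm norm_minus_commute)
      ultimately have "q \<in> ball 0 1"
        using p by simp
      then show "q \<in> ?V"
        using eq_1_near_eq_1 p q by blast
    qed
    moreover have "0 < (1 - norm p) / 4"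
      using p by simp
    ultimately show "\<exists>e>0. ball p e \<subseteq> ?V" by blast
  qed
  moreover have "ball 0 1 \<subseteq> ?U \<union> ?V"
    using h_range(2) by (auto simp: less_le)
  ultimately have "?U \<inter> ball 0 1 = {} \<or> ?V \<inter> ball 0 1 = {}"
    by (intro connectedD[OF convex_connected[OF convex_ball]]) auto
  moreover have "z0 \<in> ?U"
    using assms by simp
  ultimately have "z \<notin> ?V"
    by blast
  then show ?thesis
    using assms(3) h_range(2)[of z] by (simp add: less_le)
qed

end

section \<open>Return to the extended quotient and its extended-real logarithm\<close>

lemma comparable_pseudometrics_exists:
  assumes "conformal_pseudometric (ball 0 1) l" "conformal_pseudometric (ball 0 1) \<mu>"
    and "\<forall>z\<in>ball 0 1. 0 < \<mu> z \<longrightarrow> curvature \<mu> z = \<kappa> z"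
    and "\<forall>z\<in>ball 0 1. - c \<le> \<kappa> z \<and> \<kappa> z \<le> - 4"
    and "pseudometric_le (ball 0 1) l \<mu>"
  obtains h where "comparable_pseudometrics l \<mu> \<kappa> h c"
    "\<And>z. z \<in> ball 0 1 \<Longrightarrow> quotient_ext l \<mu> z = h z"
proof -
  obtain h where disc: "discrete {z \<in> ball 0 1. \<mu> z = 0}" and h: "continuous_on (ball 0 1) h"
      "\<And>z. z \<in> ball 0 1 \<Longrightarrow> h z \<in> {0..1}" "\<And>z. z \<in> ball 0 1 \<Longrightarrow> \<mu> z \<noteq> 0 \<Longrightarrow> h z = l z / \<mu> z"
    using assms(5) unfolding pseudometric_le_def by blast
  have "comparable_pseudometrics l \<mu> \<kappa> h c"
    using assms disc h unfolding comparable_pseudometrics_def pseudometric_le_def by auto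
  moreover have "quotient_ext l \<mu> z = h z" if "z \<in> ball 0 1" for z
    by (rule quotient_ext_eq[OF open_ball disc h(1,3) that])
  ultimately show ?thesis
    by (rule that)
qed

lemma elog_le:
  assumes "0 \<le> x" "x \<le> exp A"
  shows "elog x \<le> ereal A"
proof (cases "x = 0")
  case False
  then have "ln x \<le> ln (exp A)"
    using assms by (subst ln_le_cancel_iff) auto
  then show ?thesis
    using False by (simp add: elog_def)
qed (simp add: elog_def)

theorem theorem5p1:
  "(\<forall>r::real. 0 < r \<and> r < 1 \<longrightarrow>
      (\<exists>C>0. \<forall>(l :: complex \<Rightarrow> real) (\<mu> :: complex \<Rightarrow> real) (\<kappa> :: complex \<Rightarrow> real) (c::real).
        conformal_pseudometric (ball 0 1) l \<longrightarrow>
        conformal_pseudometric (ball 0 1) \<mu> \<longrightarrow>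
        locally_Hoelder_on (ball 0 1) \<kappa> \<longrightarrow>
        (\<forall>z\<in>ball 0 1. 0 < \<mu> z \<longrightarrow> curvature \<mu> z = \<kappa> z) \<longrightarrow>
        0 < c \<longrightarrow>
        (\<forall>z\<in>ball 0 1. - c \<le> \<kappa> z \<and> \<kappa> z \<le> - 4) \<longrightarrow>
        pseudometric_le (ball 0 1) l \<mu> \<longrightarrow>
        (\<forall>z. r \<le> norm z \<and> norm z < 1 \<longrightarrow>
          elog (quotient_ext l \<mu> z) \<le>
            ereal (C / (1 - r\<^sup>2) powr (c / 2)) *
            (SUP \<xi>\<in>sphere 0 r. elog (quotient_ext l \<mu> \<xi>)) *
            ereal ((1 - (norm z)\<^sup>2) powr (c / 2)))))
   \<and>
   (\<forall>(l :: complex \<Rightarrow> real) (\<mu> :: complex \<Rightarrow> real) (\<kappa> :: complex \<Rightarrow> real) (c::real).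
        conformal_pseudometric (ball 0 1) l \<longrightarrow>
        conformal_pseudometric (ball 0 1) \<mu> \<longrightarrow>
        locally_Hoelder_on (ball 0 1) \<kappa> \<longrightarrow>
        (\<forall>z\<in>ball 0 1. 0 < \<mu> z \<longrightarrow> curvature \<mu> z = \<kappa> z) \<longrightarrow>
        0 < c \<longrightarrow>
        (\<forall>z\<in>ball 0 1. - c \<le> \<kappa> z \<and> \<kappa> z \<le> - 4) \<longrightarrow>
        pseudometric_le (ball 0 1) l \<mu> \<longrightarrow>
        (\<exists>z0\<in>ball 0 1. quotient_ext l \<mu> z0 < 1) \<longrightarrow>
        (\<forall>z\<in>ball 0 1. quotient_ext l \<mu> z < 1) \<and>
        Limsup (filtercomap norm (at_left 1))
          (\<lambda>z::complex. elog (quotient_ext l \<mu> z) / ereal ((1 - norm z) powr (c / 2))) < 0)"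
proof (intro conjI allI impI)
  fix r :: real
  assume "0 < r \<and> r < 1"
  then have r: "0 < r" "r < 1" by auto
  let ?C = "decay_const r"
  have "elog (quotient_ext l \<mu> z) \<le> ereal (?C / (1 - r\<^sup>2) powr (c / 2)) *
      (SUP \<xi>\<in>sphere 0 r. elog (quotient_ext l \<mu> \<xi>)) * ereal ((1 - (norm z)\<^sup>2) powr (c / 2))"
    if le: "pseudometric_le (ball 0 1) l \<mu>" and hyps: "conformal_pseudometric (ball 0 1) l"
      "conformal_pseudometric (ball 0 1) \<mu>" "\<forall>z\<in>ball 0 1. 0 < \<mu> z \<longrightarrow> curvature \<mu> z = \<kappa> z"
      "\<forall>z\<in>ball 0 1. - c \<le> \<kappa> z \<and> \<kappa> z \<le> - 4"
      and z: "r \<le> norm z" "norm z < 1"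
    for l \<mu> \<kappa> :: "complex \<Rightarrow> real" and c z
  proof -
    obtain h where "comparable_pseudometrics l \<mu> \<kappa> h c"
        and q: "\<And>z. z \<in> ball 0 1 \<Longrightarrow> quotient_ext l \<mu> z = h z"
      using comparable_pseudometrics_exists[OF hyps le] by blast
    interpret comparable_pseudometrics l \<mu> \<kappa> h c by fact
    let ?S = "SUP \<xi>\<in>sphere 0 r. elog (quotient_ext l \<mu> \<xi>)"
    define k where "k = ?C * ((1 - (norm z)\<^sup>2) / (1 - r\<^sup>2)) powr (c / 2)"
    have s: "0 < 1 - (norm z)\<^sup>2" "0 < 1 - r\<^sup>2"
      using r z by (auto simp: power_less_one_iff)
    then have k: "0 < k" "k = ?C / (1 - r\<^sup>2) powr (c / 2) * (1 - (norm z)\<^sup>2) powr (c / 2)"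
      using decay_const_bounds(3)[OF r] by (auto simp: k_def powr_divide)
    have zD: "z \<in> ball 0 1" and sphere: "sphere 0 r \<subseteq> (ball 0 1 :: complex set)"
      using z r by auto
    have "sphere (0::complex) r \<noteq> {}"
      using r by simp
    then obtain \<xi> where \<xi>: "\<xi> \<in> sphere 0 r" "?S = elog (quotient_ext l \<mu> \<xi>)"
      using SUP_elog_quotient_ext_attained[OF open_ball le compact_sphere _ sphere] by blast
    have \<xi>D: "\<xi> \<in> ball 0 1"
      using \<xi>(1) sphere by blast
    have max: "h w \<le> h \<xi>" if w: "w \<in> sphere 0 r" for w
    proof -
      have wD: "w \<in> ball 0 1" using w sphere by blast
      have "elog (quotient_ext l \<mu> w) \<le> ?S"
        using w by (rule SUP_upper)
      then have "elog (h w) \<le> elog (h \<xi>)"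
        using \<xi>(2) q[OF wD] q[OF \<xi>D] by simp
      then show ?thesis
        using h_range(1)[OF wD] h_range(1)[OF \<xi>D] by (auto simp: elog_def split: if_splits)
    qed
    show ?thesis
    proof (cases "h \<xi> = 0")
      \<comment> \<open>The maximum on the circle is -infinity, so h z = 0 has to be shown. Now
        \<open>decay\<close> applies with every M \<le> 0, and M * k = ln (h z) - 1 contradicts h z
        > 0.\<close>
      case True
      have "h z = 0"
      proof (rule ccontr)
        assume "h z \<noteq> 0"
        then have hz: "0 < h z" "h z \<le> 1"
          using h_range[OF zD] by auto
        define M where "M = (ln (h z) - 1) / k"
        have "M \<le> 0"
        proof -
          have "ln (h z) \<le> 0" using hz by simp
          then show ?thesis
            unfolding M_def using k(1) by (intro divide_nonpos_pos) auto
        qed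
        moreover have "h w \<le> exp M" if "w \<in> sphere 0 r" for w
          using max[OF that] True less_imp_le[OF exp_gt_zero] by (rule order_trans[OF _ order_trans[OF eq_refl]])
        ultimately have "h z \<le> exp (M * k)"
          unfolding k_def using r z by (intro decay) auto
        also have "\<dots> = h z * exp (- 1)"
        proof -
          have "M * k = ln (h z) + - 1"
            using k(1) by (simp add: M_def)
          then show ?thesis
            using hz(1) by (simp only: exp_add exp_ln)
        qed
        also have "\<dots> < h z * 1"
          using hz(1) by (intro mult_strict_left_mono) auto
        finally show False by simp
      qed
      then show ?thesis
        using q[OF zD] by (simp add: elog_def)
    next
      case False
      then have h\<xi>: "0 < h \<xi>" "h \<xi> \<le> 1"
        using h_range[OF \<xi>D] by auto
      then have "h z \<le> exp (ln (h \<xi>) * k)"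
        unfolding k_def using r z max by (intro decay) auto
      then have "elog (h z) \<le> ereal (ln (h \<xi>) * k)"
        by (rule elog_le[OF h_range(1)[OF zD]])
      moreover have "?S = ereal (ln (h \<xi>))"
        using \<xi>(2) q[OF \<xi>D] False by (simp add: elog_def)
      ultimately show ?thesis
        using q[OF zD] by (simp add: k(2) mult_ac)
    qed
  qed
  then show "\<exists>C>0. \<forall>(l :: complex \<Rightarrow> real) (\<mu> :: complex \<Rightarrow> real) (\<kappa> :: complex \<Rightarrow> real) (c::real).
        conformal_pseudometric (ball 0 1) l \<longrightarrow>
        conformal_pseudometric (ball 0 1) \<mu> \<longrightarrow>
        locally_Hoelder_on (ball 0 1) \<kappa> \<longrightarrow>
        (\<forall>z\<in>ball 0 1. 0 < \<mu> z \<longrightarrow> curvature \<mu> z = \<kappa> z) \<longrightarrow>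
        0 < c \<longrightarrow>
        (\<forall>z\<in>ball 0 1. - c \<le> \<kappa> z \<and> \<kappa> z \<le> - 4) \<longrightarrow>
        pseudometric_le (ball 0 1) l \<mu> \<longrightarrow>
        (\<forall>z. r \<le> norm z \<and> norm z < 1 \<longrightarrow>
          elog (quotient_ext l \<mu> z) \<le>
            ereal (C / (1 - r\<^sup>2) powr (c / 2)) *
            (SUP \<xi>\<in>sphere 0 r. elog (quotient_ext l \<mu> \<xi>)) *
            ereal ((1 - (norm z)\<^sup>2) powr (c / 2)))"
    using decay_const_bounds(3)[OF r] by (intro exI[of _ ?C]) blast
next
  fix l \<mu> \<kappa> :: "complex \<Rightarrow> real" and c z
  assume hyps: "conformal_pseudometric (ball 0 1) l" "conformal_pseudometric (ball 0 1) \<mu>"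
      "\<forall>z\<in>ball 0 1. 0 < \<mu> z \<longrightarrow> curvature \<mu> z = \<kappa> z" "\<forall>z\<in>ball 0 1. - c \<le> \<kappa> z \<and> \<kappa> z \<le> - 4"
      "pseudometric_le (ball 0 1) l \<mu>"
    and z0: "\<exists>z0\<in>ball 0 1. quotient_ext l \<mu> z0 < 1"
  obtain h where "comparable_pseudometrics l \<mu> \<kappa> h c"
      and q: "\<And>z. z \<in> ball 0 1 \<Longrightarrow> quotient_ext l \<mu> z = h z"
    using comparable_pseudometrics_exists[OF hyps] by blast
  interpret comparable_pseudometrics l \<mu> \<kappa> h c by fact
  obtain z0 where "z0 \<in> ball 0 1" "h z0 < 1"
    using z0 q by metis
  note less = strong_maximum_principle[OF this]
  then show "\<forall>z\<in>ball 0 1. quotient_ext l \<mu> z < 1"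
    using q by metis
  \<comment> \<open>Any radius in (0,1) would do, since the limit superior only sees |z| near
    1.\<close>
  define r :: real where "r = 1 / 2"
  have r: "0 < r" "r < 1" by (auto simp: r_def)
  have "sphere 0 r \<subseteq> (ball 0 1 :: complex set)"
    using r by auto
  with less r obtain M where M: "M < 0" "\<And>w. w \<in> sphere 0 r \<Longrightarrow> h w \<le> exp M"
    using sphere_bound[of r 0] by blast
  let ?C = "decay_const r"
  have bound: "elog (quotient_ext l \<mu> z) / ereal ((1 - norm z) powr (c / 2)) \<le> ereal (M * ?C)"
    if z: "r < norm z" "norm z < 1" for z
  proof -
    have zD: "z \<in> ball 0 1" using z by simp
    \<comment> \<open>Factoring 1 - |z|^2 = (1 - |z|)(1 + |z|) and using 1 + |z| \<ge> 1 \<ge> 1 -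
      r^2 passes to powers of 1 - |z| without a further constant.\<close>
    have "1 - norm z \<le> (1 - (norm z)\<^sup>2) / (1 - r\<^sup>2)"
    proof -
      have "(1 - norm z) * (1 - r\<^sup>2) \<le> (1 - norm z) * (1 + norm z)"
        using z zero_le_power2[of r] norm_ge_zero[of z] by (intro mult_left_mono; linarith)
      also have "\<dots> = 1 - (norm z)\<^sup>2"
        by (simp add: power2_eq_square algebra_simps)
      finally show ?thesis
        using r by (subst pos_le_divide_eq) (auto simp: power_less_one_iff)
    qed
    then have "(1 - norm z) powr (c / 2) \<le> ((1 - (norm z)\<^sup>2) / (1 - r\<^sup>2)) powr (c / 2)"
      using z c_ge_4 by (intro powr_mono2) auto
    then have "M * (?C * ((1 - (norm z)\<^sup>2) / (1 - r\<^sup>2)) powr (c / 2)) \<le> M * (?C * (1 - norm z) powr (c / 2))"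
      using M(1) decay_const_bounds(3)[OF r] by (intro mult_left_mono_neg mult_left_mono) auto
    moreover have "h z \<le> exp (M * (?C * ((1 - (norm z)\<^sup>2) / (1 - r\<^sup>2)) powr (c / 2)))"
      using r z M by (intro decay) auto
    ultimately have "h z \<le> exp (M * (?C * (1 - norm z) powr (c / 2)))"
      by (smt (verit) exp_le_cancel_iff)
    then have "elog (h z) \<le> ereal (M * (?C * (1 - norm z) powr (c / 2)))"
      by (rule elog_le[OF h_range(1)[OF zD]])
    moreover have pos: "0 < (1 - norm z) powr (c / 2)"
      using z by simp
    ultimately have "elog (h z) / ereal ((1 - norm z) powr (c / 2)) \<le>
        ereal (M * (?C * (1 - norm z) powr (c / 2))) / ereal ((1 - norm z) powr (c / 2))"
      by (intro ereal_divide_right_mono) auto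
    also have "\<dots> = ereal (M * ?C)"
      using pos by simp
    finally show ?thesis
      using q[OF zD] by simp
  qed
  have "\<forall>\<^sub>F x in at_left 1. x \<in> {r<..<1}"
    using r(2) by (rule eventually_at_left_real)
  then have "\<forall>\<^sub>F z in filtercomap norm (at_left 1). norm (z::complex) \<in> {r<..<1}"
    by (rule eventually_filtercomapI)
  then have "\<forall>\<^sub>F z::complex in filtercomap norm (at_left 1).
      elog (quotient_ext l \<mu> z) / ereal ((1 - norm z) powr (c / 2)) \<le> ereal (M * ?C)"
    by eventually_elim (auto intro: bound)
  then have "Limsup (filtercomap norm (at_left 1))
      (\<lambda>z::complex. elog (quotient_ext l \<mu> z) / ereal ((1 - norm z) powr (c / 2))) \<le> ereal (M * ?C)"
    by (rule Limsup_bounded)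
  also have "\<dots> < 0"
    using M(1) decay_const_bounds(3)[OF r] by (simp add: mult_neg_pos)
  finally show "Limsup (filtercomap norm (at_left 1))
      (\<lambda>z::complex. elog (quotient_ext l \<mu> z) / ereal ((1 - norm z) powr (c / 2))) < 0" .
qed

end
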